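(* \[ \lim_{n\to\infty} \frac{\log \mathcal{Q}(n)}{n \log n} = 1. \]
   Context: Write $[n]=\{1,\dots,n\}$ and identify the $n\times n$ chessboard with $[n]^2$. An $n$-queens configuration is a set $Q\subset[n]^2$ of size $n$ such that every row, every column, and every (non-toroidal) diagonal, i.e. every set of the form $\{(x,y)\in[n]^2: x+y=a\}$ or $\{(x,y)\in[n]^2: x-y=b\}$ with $a,b$ integers, contains at most one element of $Q$. $\mathcal{Q}(n)$ denotes the number of $n$-queens configurations. (The expression $\log\mathcal{Q}(n)$ is considered for all sufficiently large $n$, for which $\mathcal{Q}(n)>0$.) *)

theory Defs
  imports "HOL-Analysis.Analysis"
begin

text \<open>Squares have integer coordinates so that \<open>x - y\<close> is true (not truncated) subtraction.\<close>

definition board :: "nat \<Rightarrow> (int \<times> int) set" where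
  "board n = {1..int n} \<times> {1..int n}"

definition rows :: "nat \<Rightarrow> (int \<times> int) set set" where
  "rows n = {{(x, y) \<in> board n. y = r} | r. r \<in> {1..int n}}"

definition columns :: "nat \<Rightarrow> (int \<times> int) set set" where
  "columns n = {{(x, y) \<in> board n. x = c} | c. c \<in> {1..int n}}"

definition diagonals :: "nat \<Rightarrow> (int \<times> int) set set" where
  "diagonals n =
     {{(x, y) \<in> board n. x + y = a} | a. True} \<union> {{(x, y) \<in> board n. x - y = b} | b. True}"

definition queens_configuration :: "nat \<Rightarrow> (int \<times> int) set \<Rightarrow> bool" where
  "queens_configuration n Q \<longleftrightarrow>
     Q \<subseteq> board n \<and> card Q = n \<and>
     (\<forall>L \<in> rows n \<union> columns n \<union> diagonals n. card (Q \<inter> L) \<le> 1)"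

definition num_queens :: "nat \<Rightarrow> nat" where
  "num_queens n = card {Q. queens_configuration n Q}"

end

theory Submission
  imports Defs "HOL-Number_Theory.Number_Theory" "HOL-Real_Asymp.Real_Asymp"
begin

text \<open>
  The upper bound is the trivial one: a configuration is the graph of a function on the columns, so
  there are at most \<open>n ^ n\<close> of them. For the lower bound, \<open>n ^ ((1 - \<epsilon>) n)\<close> almost complete
  placements are produced by a random greedy process, and each of them is completed by switchings
  after losing only a bounded number of queens.

  \<^bold>\<open>Almost complete placements.\<close> On a torus the lines through the squares form a linear, regular,
  4-uniform hypergraph: a square is an edge, and its vertices are its column, its row and its two
  diagonals. Draw squares independently and keep each one that meets no line already occupied. If
  \<open>P S i\<close> is the probability that the set \<open>S\<close> of lines is still free after \<open>i\<close> draws, then \<open>P\<close> obeys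
  an exact linear recurrence in which \<open>P S\<close> is driven by \<open>P (S \<union> f)\<close> for squares \<open>f\<close> meeting \<open>S\<close>. By
  linearity and regularity its solution is close to \<open>U i ^ card S\<close> with \<open>U' = - U ^ 4\<close>, and an
  explicit supersolution bounds the error (\<open>error_bound\<close>). So after a constant number of draws per
  vertex almost all lines are occupied. A fixed matching arises only if all of its squares are
  drawn, which is unlikely; hence there are many matchings (\<open>many_near_perfect_matchings\<close>).

  \<^bold>\<open>Completion.\<close> The random part must leave room for repairs. Fix five large primes \<open>p 1, \<dots>, p 5\<close> and
  a modulus \<open>N\<close>, slightly below \<open>n\<close> and divisible by all of them. The random squares \<open>(x, y)\<close> satisfy
  \<open>y = 3 x\<close> modulo the product of the primes, with \<open>x\<close> divisible by none of them; then none of their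
  four lines is divisible by any of them. The few remaining columns are filled
  deterministically: those with \<open>p 1 dvd x\<close> by the queens \<open>y = 24 x (mod N)\<close>, and the others by
  \<open>y = 3 x (mod N)\<close>. If column \<open>u\<close> and row \<open>v\<close> are still empty, a queen \<open>(x, y)\<close> of slope 24 is traded
  for the two queens \<open>(u, y)\<close> and \<open>(x, v)\<close>. Their diagonals are free if each is divisible by one of
  \<open>p 2, \<dots>, p 5\<close>, which avoids the random queens; if \<open>u\<close> and \<open>v\<close> are not divisible by \<open>p 1\<close>, which
  avoids the queens of slope 24; and if the diagonals lie among the real diagonals that the line of
  slope 3 leaves empty, since that line uses only one of the two real diagonals belonging to a
  diagonal of the torus. These are congruence conditions on \<open>x\<close>, so linearly many \<open>(x, y)\<close> qualify
  (\<open>candidates\<close>), more than the switchings can ever block (\<open>absorb\<close>, \<open>completion\<close>).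
\<close>

section \<open>Counting near-perfect matchings by a random greedy process\<close>

text \<open>The newest element of the word is at its head; it is accepted if it is disjoint from everything
  accepted before. The probability space of the process is the finite set of words over \<open>E\<close> of a
  given length, so that all probabilities below are ratios of cardinalities.\<close>
fun greedy :: "('e \<Rightarrow> 'v set) \<Rightarrow> 'e list \<Rightarrow> 'e set" where
  "greedy vs [] = {}"
| "greedy vs (f # w) =
    (if vs f \<inter> \<Union> (vs ` greedy vs w) = {} then insert f (greedy vs w) else greedy vs w)"

lemma greedy_subset: "greedy vs w \<subseteq> set w"
  by (induction w) auto

lemma greedy_disjoint:
  "e \<in> greedy vs w \<Longrightarrow> f \<in> greedy vs w \<Longrightarrow> e \<noteq> f \<Longrightarrow> vs e \<inter> vs f = {}"
proof (induction w)
  case (Cons a w)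
  show ?case
  proof (cases "vs a \<inter> \<Union> (vs ` greedy vs w) = {}")
    case True
    then have eq: "greedy vs (a # w) = insert a (greedy vs w)"
      unfolding greedy.simps by (rule if_P)
    have new: "vs a \<inter> vs g = {}" if "g \<in> greedy vs w" for g
      using True that by blast
    show ?thesis
      using Cons.prems Cons.IH new[of e] new[of f] unfolding eq by (metis Int_commute insertE)
  next
    case False
    then have eq: "greedy vs (a # w) = greedy vs w"
      unfolding greedy.simps by (rule if_not_P)
    show ?thesis using Cons.IH Cons.prems unfolding eq by blast
  qed
qed simp

text \<open>A union bound over the positions at which the elements of \<open>G\<close> occur. It limits how often the
  process can produce one given matching.\<close>
lemma card_words_containing:
  assumes "finite E" "finite G" "E \<noteq> {}"
  shows "real (card {w. set w \<subseteq> E \<and> length w = l \<and> G \<subseteq> set w})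
           \<le> (real l / real (card E)) ^ card G * real (card E) ^ l"
  using assms(2)
proof (induction l arbitrary: G)
  case 0
  have "{w. set w \<subseteq> E \<and> length w = 0 \<and> G \<subseteq> set w} = (if G = {} then {[]} else {})" by auto
  then show ?case using 0 by (auto simp: card_gt_0_iff)
next
  case (Suc l)
  define N where "N = (\<lambda>l G. {w. set w \<subseteq> E \<and> length w = l \<and> G \<subseteq> set w})"
  define c where "c = real (card E)"
  have c0: "c > 0" using assms by (simp add: c_def card_gt_0_iff)
  have finN: "finite (N l G)" for l G
    by (rule finite_subset[OF _ finite_lists_length_eq[OF assms(1), of l]]) (auto simp: N_def)
  have IH: "real (card (N l G)) \<le> (real l / c) ^ card G * c ^ l" if "finite G" for G
    using Suc.IH[OF that] by (simp add: N_def c_def)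
  let ?g = "card G"
  have sub: "N (Suc l) G \<subseteq> (\<Union>a\<in>G. (#) a ` N l (G - {a})) \<union> (\<lambda>(a, w). a # w) ` (E \<times> N l G)"
  proof
    fix w assume w: "w \<in> N (Suc l) G"
    then obtain a v where av: "w = a # v" "length v = l" "a \<in> E" "set v \<subseteq> E" "G \<subseteq> insert a (set v)"
      by (cases w) (auto simp: N_def)
    show "w \<in> (\<Union>a\<in>G. (#) a ` N l (G - {a})) \<union> (\<lambda>(a, w). a # w) ` (E \<times> N l G)"
    proof (cases "a \<in> G")
      case True
      then show ?thesis using av by (auto simp: N_def)
    next
      case False
      then have "v \<in> N l G" using av by (auto simp: N_def)
      then show ?thesis using av by auto
    qed
  qed
  have "real (card (N (Suc l) G)) \<le> real (card (\<Union>a\<in>G. (#) a ` N l (G - {a})) + card ((\<lambda>(a, w). a # w) ` (E \<times> N l G)))"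
    using card_mono[OF _ sub] card_Un_le Suc.prems finN assms(1)
    by (smt (verit, ccfv_SIG) finite_SigmaI finite_UN finite_UnI finite_imageI le_trans of_nat_mono)
  also have "\<dots> \<le> real ?g * ((real l / c) ^ (?g - 1) * c ^ l) + c * ((real l / c) ^ ?g * c ^ l)"
  proof -
    have "card (\<Union>a\<in>G. (#) a ` N l (G - {a})) \<le> (\<Sum>a\<in>G. card (N l (G - {a})))"
      using card_UN_le[OF Suc.prems, of "\<lambda>a. (#) a ` N l (G - {a})"] by (simp add: card_image)
    then have "real (card (\<Union>a\<in>G. (#) a ` N l (G - {a}))) \<le> (\<Sum>a\<in>G. real (card (N l (G - {a}))))"
      by (simp flip: of_nat_sum)
    also have "\<dots> \<le> (\<Sum>a\<in>G. (real l / c) ^ (?g - 1) * c ^ l)"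
    proof (rule sum_mono)
      fix a assume "a \<in> G"
      then show "real (card (N l (G - {a}))) \<le> (real l / c) ^ (?g - 1) * c ^ l"
        using IH[of "G - {a}"] Suc.prems by simp
    qed
    finally have 1: "real (card (\<Union>a\<in>G. (#) a ` N l (G - {a}))) \<le> real ?g * ((real l / c) ^ (?g - 1) * c ^ l)" by simp
    have "card ((\<lambda>(a, w). a # w) ` (E \<times> N l G)) \<le> card E * card (N l G)"
      by (metis assms(1) card_cartesian_product card_image_le finN finite_SigmaI)
    then have "real (card ((\<lambda>(a, w). a # w) ` (E \<times> N l G))) \<le> c * real (card (N l G))"
      unfolding c_def by (metis of_nat_mono of_nat_mult)
    also have "\<dots> \<le> c * ((real l / c) ^ ?g * c ^ l)" using IH[OF Suc.prems] c0 by simp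
    finally show ?thesis using 1 by simp
  qed
  also have "\<dots> \<le> (real (Suc l) / c) ^ ?g * c ^ Suc l"
  proof -
    have key: "real g * real l ^ (g - 1) + real l ^ g \<le> real (Suc l) ^ g" for g
    proof (induction g)
      case (Suc g)
      have "real (Suc l) ^ Suc g = (real l + 1) * real (Suc l) ^ g" by simp
      moreover have "(real l + 1) * (real g * real l ^ (g - 1) + real l ^ g) \<le> (real l + 1) * real (Suc l) ^ g"
        using Suc.IH by (intro mult_left_mono) auto
      moreover have "real l * (real g * real l ^ (g - 1)) = real g * real l ^ g"
        by (cases g) auto
      moreover have "real g * real l ^ (g - 1) \<ge> 0" by simp
      moreover have "(real l + 1) * (real g * real l ^ (g - 1) + real l ^ g)
          = real l * (real g * real l ^ (g - 1)) + real g * real l ^ (g - 1) + real l ^ Suc g + real l ^ g"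
        by (simp add: algebra_simps)
      moreover have "real (Suc g) * real l ^ (Suc g - 1) = real g * real l ^ g + real l ^ g"
        by (simp add: algebra_simps)
      ultimately show ?case by linarith
    qed simp
    have e: "real ?g * ((real l / c) ^ (?g - 1) * c ^ l) = c ^ Suc l / c ^ ?g * (real ?g * real l ^ (?g - 1))"
      using c0 by (cases ?g) (auto simp: power_divide field_simps)
    have e2: "c * ((real l / c) ^ ?g * c ^ l) = c ^ Suc l / c ^ ?g * real l ^ ?g"
      using c0 by (simp add: power_divide field_simps)
    have e3: "(real (Suc l) / c) ^ ?g * c ^ Suc l = c ^ Suc l / c ^ ?g * real (Suc l) ^ ?g"
      using c0 by (simp add: power_divide field_simps)
    show ?thesis unfolding e e2 e3 distrib_left[symmetric]
      by (rule mult_left_mono[OF key]) (use c0 in auto)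
  qed
  finally show ?case by (simp add: N_def c_def)
qed

locale regular_linear_hypergraph =
  fixes V :: "'v set" and E :: "'e set" and vs :: "'e \<Rightarrow> 'v set" and D M :: nat
  assumes finV: "finite V" and finE: "finite E"
    and vs_sub: "e \<in> E \<Longrightarrow> vs e \<subseteq> V"
    and card_vs: "e \<in> E \<Longrightarrow> card (vs e) = 4"
    and degree: "v \<in> V \<Longrightarrow> card {e \<in> E. v \<in> vs e} = D"
    and linear: "e \<in> E \<Longrightarrow> f \<in> E \<Longrightarrow> u \<in> vs e \<Longrightarrow> u \<in> vs f \<Longrightarrow>
                   v \<in> vs e \<Longrightarrow> v \<in> vs f \<Longrightarrow> u \<noteq> v \<Longrightarrow> e = f"
    and cardV: "card V = 4 * M"
    and D_pos: "0 < D" and D_le_M: "D \<le> M"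
begin

definition covered :: "'e list \<Rightarrow> 'v set" where "covered w = \<Union> (vs ` greedy vs w)"
definition words :: "nat \<Rightarrow> 'e list set" where "words i = {w. set w \<subseteq> E \<and> length w = i}"
definition cnt :: "'v set \<Rightarrow> nat \<Rightarrow> nat" where
  "cnt S i = card {w \<in> words i. S \<inter> covered w = {}}"
definition P :: "'v set \<Rightarrow> nat \<Rightarrow> real" where "P S i = real (cnt S i) / real (card E) ^ i"

lemma covered_Cons:
  "covered (f # w) = (if vs f \<inter> covered w = {} then covered w \<union> vs f else covered w)"
proof (cases "vs f \<inter> \<Union> (vs ` greedy vs w) = {}")
  case True
  then show ?thesis unfolding covered_def greedy.simps if_P[OF True] by (simp add: Un_commute)
next
  case False
  then show ?thesis unfolding covered_def greedy.simps if_not_P[OF False] by simp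
qed

lemma incidences:
  assumes "S \<subseteq> V"
  shows "(\<Sum>f\<in>E. card (vs f \<inter> S)) = card S * D"
proof -
  have finS: "finite S" using assms finV finite_subset by auto
  have "(\<Sum>f\<in>E. card (vs f \<inter> S)) = (\<Sum>f\<in>E. \<Sum>v\<in>S. if v \<in> vs f then 1 else 0)"
    using finS by (intro sum.cong refl) (simp add: sum.If_cases Int_commute Int_def conj_commute)
  also have "\<dots> = (\<Sum>v\<in>S. \<Sum>f\<in>E. if v \<in> vs f then 1 else 0)" by (rule sum.swap)
  also have "\<dots> = (\<Sum>v\<in>S. D)"
    using degree assms finE by (intro sum.cong refl) (auto simp: sum.If_cases Int_def)
  finally show ?thesis by simp
qed

lemma cardE: "card E = D * M"
proof -
  have "(\<Sum>f\<in>E. card (vs f \<inter> V)) = (\<Sum>f\<in>E. 4)"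
    using vs_sub card_vs by (intro sum.cong refl) (simp add: Int_absorb2)
  then have "card E * 4 = card V * D" using incidences[of V] by simp
  then show ?thesis using cardV by simp
qed

lemma M_pos: "0 < M" using D_pos D_le_M by simp
lemma cardE_pos: "0 < card E" using cardE D_pos M_pos by simp

lemma finite_words: "finite (words i)"
  unfolding words_def by (rule finite_lists_length_eq[OF finE])

lemma card_words: "card (words i) = card E ^ i"
  unfolding words_def by (rule card_lists_length_eq[OF finE])

text \<open>After one more draw \<open>f\<close> the set \<open>S\<close> is free unless it was free before and \<open>f\<close> meets it and is
  accepted; the two latter events say precisely that \<open>S \<union> vs f\<close> was free.\<close>
lemma cnt_Suc:
  "real (cnt S (Suc i)) =
     real (card E) * real (cnt S i) - (\<Sum>f\<in>{f \<in> E. vs f \<inter> S \<noteq> {}}. real (cnt (S \<union> vs f) i))"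
proof -
  let ?A = "\<lambda>S. {w \<in> words i. S \<inter> covered w = {}}"
  let ?B = "\<lambda>f. {w \<in> words i. S \<inter> covered (f # w) = {}}"
  have fin: "finite (?A S)" "finite (?B f)" for S f using finite_words by auto
  have eq: "{w \<in> words (Suc i). S \<inter> covered w = {}} = (\<Union>f\<in>E. (#) f ` ?B f)"
  proof (intro equalityI subsetI)
    fix w assume w: "w \<in> {w \<in> words (Suc i). S \<inter> covered w = {}}"
    then obtain f v where "w = f # v" by (cases w) (auto simp: words_def)
    then show "w \<in> (\<Union>f\<in>E. (#) f ` ?B f)" using w by (auto simp: words_def)
  qed (auto simp: words_def)
  have "cnt S (Suc i) = (\<Sum>f\<in>E. card ((#) f ` ?B f))"
    unfolding cnt_def eq
    by (rule card_UN_disjoint) (use fin(2) finE in \<open>auto simp del: Int_iff\<close>)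
  also have "\<dots> = (\<Sum>f\<in>E. card (?B f))" by (simp add: card_image)
  finally have "real (cnt S (Suc i)) = (\<Sum>f\<in>E. real (card (?B f)))" by simp
  also have "\<dots> = (\<Sum>f\<in>E. real (cnt S i) - (if vs f \<inter> S \<noteq> {} then real (cnt (S \<union> vs f) i) else 0))"
  proof (rule sum.cong[OF refl])
    fix f assume "f \<in> E"
    show "real (card (?B f)) = real (cnt S i) - (if vs f \<inter> S \<noteq> {} then real (cnt (S \<union> vs f) i) else 0)"
    proof (cases "vs f \<inter> S = {}")
      case True
      then have "S \<inter> covered (f # w) = {} \<longleftrightarrow> S \<inter> covered w = {}" for w
        unfolding covered_Cons by (simp add: Int_Un_distrib Int_commute)
      then show ?thesis using True by (simp add: cnt_def)
    next
      case False
      then have "S \<inter> covered (f # w) = {} \<longleftrightarrow>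
          S \<inter> covered w = {} \<and> \<not> (S \<union> vs f) \<inter> covered w = {}" for w
        unfolding covered_Cons by (simp add: Int_Un_distrib Int_Un_distrib2 Int_commute)
      then have eq: "?B f = ?A S - ?A (S \<union> vs f)" by blast
      have sub: "?A (S \<union> vs f) \<subseteq> ?A S" by blast
      have "card (?B f) = card (?A S) - card (?A (S \<union> vs f))"
        unfolding eq using fin(1) sub by (rule card_Diff_subset)
      moreover have "card (?A (S \<union> vs f)) \<le> card (?A S)" using fin(1) sub by (rule card_mono)
      ultimately show ?thesis using False by (simp add: cnt_def)
    qed
  qed
  also have "\<dots> = real (card E) * real (cnt S i) - (\<Sum>f\<in>E. if vs f \<inter> S \<noteq> {} then real (cnt (S \<union> vs f) i) else 0)"
    by (simp add: sum_subtractf)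
  also have "(\<Sum>f\<in>E. if vs f \<inter> S \<noteq> {} then real (cnt (S \<union> vs f) i) else 0)
     = (\<Sum>f\<in>{f \<in> E. vs f \<inter> S \<noteq> {}}. real (cnt (S \<union> vs f) i))"
    by (rule sum.inter_filter[OF finE, symmetric])
  finally show ?thesis .
qed

lemma P_Suc:
  "P S (Suc i) = P S i - (\<Sum>f\<in>{f \<in> E. vs f \<inter> S \<noteq> {}}. P (S \<union> vs f) i) / real (card E)"
proof -
  let ?H = "{f \<in> E. vs f \<inter> S \<noteq> {}}" and ?c = "real (card E)"
  have "(\<Sum>f\<in>?H. P (S \<union> vs f) i) = (\<Sum>f\<in>?H. real (cnt (S \<union> vs f) i)) / ?c ^ i"
    unfolding P_def by (rule sum_divide_distrib[symmetric])
  then show ?thesis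
    unfolding P_def[of S] cnt_Suc using cardE_pos by (simp add: field_simps)
qed

lemma P_0: "P S 0 = 1"
proof -
  have "{w \<in> words 0. S \<inter> covered w = {}} = {[]}" by (auto simp: words_def covered_def)
  then show ?thesis by (simp add: P_def cnt_def)
qed

lemma P_empty: "P {} i = 1"
  using cardE_pos by (simp add: P_def cnt_def card_words)

lemma P_nonneg: "0 \<le> P S i" by (simp add: P_def)

lemma P_le_1: "P S i \<le> 1"
proof -
  have "cnt S i \<le> card E ^ i"
    unfolding cnt_def card_words[symmetric] using finite_words by (intro card_mono) auto
  then have "real (cnt S i) \<le> real (card E) ^ i" by (simp flip: of_nat_power)
  then show ?thesis using cardE_pos by (simp add: P_def divide_le_eq)
qed

text \<open>Two vertices determine an edge, so few edges meet \<open>S\<close> more than once.\<close>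
lemma card_multi:
  assumes "S \<subseteq> V"
  shows "card {f \<in> E. card (vs f \<inter> S) \<ge> 2} \<le> card S ^ 2"
proof -
  have finS: "finite S" using assms finV finite_subset by auto
  let ?F = "{f \<in> E. card (vs f \<inter> S) \<ge> 2}"
  have "\<forall>f\<in>?F. \<exists>p. fst p \<in> vs f \<inter> S \<and> snd p \<in> vs f \<inter> S \<and> fst p \<noteq> snd p"
  proof
    fix f assume "f \<in> ?F"
    then have "2 \<le> card (vs f \<inter> S)" by simp
    then obtain T where "T \<subseteq> vs f \<inter> S" "card T = 2" by (rule obtain_subset_with_card_n)
    then obtain a b where "a \<noteq> b" "{a, b} \<subseteq> vs f \<inter> S" by (auto simp: card_2_iff)
    then show "\<exists>p. fst p \<in> vs f \<inter> S \<and> snd p \<in> vs f \<inter> S \<and> fst p \<noteq> snd p"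
      by (intro exI[of _ "(a, b)"]) auto
  qed
  then obtain h where h: "\<And>f. f \<in> ?F \<Longrightarrow> fst (h f) \<in> vs f \<inter> S \<and> snd (h f) \<in> vs f \<inter> S \<and> fst (h f) \<noteq> snd (h f)"
    by metis
  have "inj_on h ?F"
  proof (rule inj_onI)
    fix e f assume "e \<in> ?F" "f \<in> ?F" "h e = h f"
    then show "e = f" using linear[of e f "fst (h e)" "snd (h e)"] h[of e] h[of f] by auto
  qed
  moreover have "h ` ?F \<subseteq> S \<times> S"
  proof
    fix p assume "p \<in> h ` ?F"
    then obtain f where "f \<in> ?F" "p = h f" by blast
    then show "p \<in> S \<times> S" using h[of f] by (simp add: mem_Times_iff)
  qed
  ultimately have "card ?F \<le> card (S \<times> S)" using finS by (intro card_inj_on_le) auto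
  then show ?thesis by (simp add: power2_eq_square card_cartesian_product)
qed

text \<open>Edges meeting \<open>S\<close> once are counted by regularity, and the others contribute at most a constant
  times the square of the size of \<open>S\<close>. With \<open>g f = P (S \<union> vs f) i\<close> this turns the recurrence for \<open>P\<close> into one that involves
  set sizes only.\<close>
lemma hitting_sum:
  assumes S: "S \<subseteq> V" and u: "0 \<le> u" "u \<le> 1" and \<eta>: "0 \<le> \<eta>"
    and g: "\<And>f. f \<in> E \<Longrightarrow> 0 \<le> g f \<and> g f \<le> 1"
    and g1: "\<And>f. f \<in> E \<Longrightarrow> card (vs f \<inter> S) = 1 \<Longrightarrow> \<bar>g f - u\<bar> \<le> \<eta>"
  shows "\<bar>(\<Sum>f\<in>{f \<in> E. vs f \<inter> S \<noteq> {}}. g f) - real (card S * D) * u\<bar>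
           \<le> real (card S * D) * \<eta> + 4 * real (card S) ^ 2"
proof -
  have finS: "finite S" using S finV finite_subset by auto
  let ?H = "{f \<in> E. vs f \<inter> S \<noteq> {}}"
  let ?k = "\<lambda>f. card (vs f \<inter> S)"
  let ?F = "{f \<in> E. ?k f \<ge> 2}"
  have finH: "finite ?H" using finE by simp
  have kH: "(\<Sum>f\<in>?H. ?k f) = card S * D"
  proof -
    have "(\<Sum>f\<in>?H. ?k f) = (\<Sum>f\<in>E. ?k f)"
      using finE by (intro sum.mono_neutral_left) auto
    then show ?thesis using incidences[OF S] by simp
  qed
  have k1: "1 \<le> ?k f" if "f \<in> ?H" for f
    using that finS by (auto simp: Suc_le_eq card_gt_0_iff)
  have k4: "?k f \<le> 4" if "f \<in> ?H" for f
  proof -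
    have "f \<in> E" using that by simp
    then have "finite (vs f)" using vs_sub finV finite_subset by blast
    then show ?thesis using card_mono[of "vs f" "vs f \<inter> S"] card_vs[OF \<open>f \<in> E\<close>] by auto
  qed
  have "(\<Sum>f\<in>?H. g f) - real (card S * D) * u = (\<Sum>f\<in>?H. g f - real (?k f) * u)"
    unfolding kH[symmetric] by (simp add: sum_subtractf sum_distrib_right)
  also have "\<bar>\<dots>\<bar> \<le> (\<Sum>f\<in>?H. \<bar>g f - real (?k f) * u\<bar>)" by (rule sum_abs)
  also have "\<dots> \<le> (\<Sum>f\<in>?H. real (?k f) * \<eta> + (if f \<in> ?F then 4 else 0))"
  proof (rule sum_mono)
    fix f assume f: "f \<in> ?H"
    then have fE: "f \<in> E" by simp
    show "\<bar>g f - real (?k f) * u\<bar> \<le> real (?k f) * \<eta> + (if f \<in> ?F then 4 else 0)"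
    proof (cases "?k f = 1")
      case True
      then show ?thesis using g1[OF fE True] by simp
    next
      case False
      then have F: "f \<in> ?F" using k1[OF f] fE by auto
      have "real (?k f) * u \<le> 4 * 1" using k4[OF f] u by (intro mult_mono) auto
      moreover have "0 \<le> real (?k f) * u" "0 \<le> real (?k f) * \<eta>" using u \<eta> by auto
      ultimately show ?thesis using F g[OF fE] by auto
    qed
  qed
  also have "\<dots> = real (card S * D) * \<eta> + 4 * real (card ?F)"
  proof -
    have "?H \<inter> ?F = ?F" by auto
    then have "(\<Sum>f\<in>?H. if f \<in> ?F then 4 else 0) = 4 * real (card ?F)"
      using sum.inter_restrict[OF finH, of "\<lambda>_. 4::real" ?F] by simp
    then show ?thesis unfolding kH[symmetric] by (simp add: sum.distrib sum_distrib_right)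
  qed
  also have "\<dots> \<le> real (card S * D) * \<eta> + 4 * real (card S) ^ 2"
    using card_multi[OF S] by (simp flip: of_nat_power)
  finally show ?thesis .
qed

end

lemma square_le_exp:
  fixes x :: real
  assumes "0 \<le> x"
  shows "x\<^sup>2 \<le> exp x"
proof -
  have "x \<le> 1 + x / 2 + (x / 2)\<^sup>2 / 2"
    using zero_le_power2[of "x - 2"] by (simp add: power2_eq_square algebra_simps)
  also have "\<dots> \<le> exp (x / 2)" using assms by (intro exp_lower_Taylor_quadratic) auto
  finally have "x\<^sup>2 \<le> (exp (x / 2))\<^sup>2" using assms by (intro power_mono)
  then show ?thesis by (simp flip: exp_double)
qed

lemma one_minus_power_approx:
  fixes z :: real
  assumes "0 \<le> z" "z \<le> 1"
  shows "\<bar>(1 - z) ^ m - (1 - real m * z)\<bar> \<le> (real m * z)\<^sup>2"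
proof -
  have lower: "1 - real m * z \<le> (1 - z) ^ m"
    using Bernoulli_inequality[of "- z" m] assms by simp
  have upper: "(1 - z) ^ m \<le> 1 - real m * z + (real m * z)\<^sup>2"
  proof (induction m)
    case (Suc m)
    have "(1 - z) ^ Suc m \<le> (1 - z) * (1 - real m * z + (real m * z)\<^sup>2)"
      using Suc assms by (simp add: mult_left_mono)
    also have "\<dots> = 1 - real (Suc m) * z + ((real m)\<^sup>2 + real m) * z\<^sup>2 - (real m)\<^sup>2 * z ^ 3"
      by (simp add: algebra_simps power2_eq_square power3_eq_cube)
    also have "\<dots> \<le> 1 - real (Suc m) * z + (real (Suc m))\<^sup>2 * z\<^sup>2"
    proof -
      have "((real m)\<^sup>2 + real m) * z\<^sup>2 \<le> (real (Suc m))\<^sup>2 * z\<^sup>2"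
        by (intro mult_right_mono) (auto simp: power2_eq_square algebra_simps)
      moreover have "0 \<le> (real m)\<^sup>2 * z ^ 3" using assms by simp
      ultimately show ?thesis by linarith
    qed
    finally show ?case by (simp add: power_mult_distrib)
  qed simp
  show ?thesis using lower upper by auto
qed

lemma le_one_minus_exp:
  fixes z :: real
  assumes "0 \<le> z" "z \<le> 1 / 2"
  shows "z \<le> 1 - exp (- 2 * z)"
proof -
  have "exp (- 2 * z) = 1 / exp (2 * z)" by (simp add: exp_minus field_simps)
  also have "\<dots> \<le> 1 / (1 + 2 * z)"
    using assms by (intro divide_left_mono) (auto simp: exp_ge_add_one_self)
  also have "\<dots> \<le> 1 - z"
  proof -
    have "0 \<le> z * (1 - 2 * z)" using assms by simp
    then have "1 \<le> (1 - z) * (1 + 2 * z)" by (simp add: algebra_simps)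
    then show ?thesis using assms by (simp add: divide_le_eq)
  qed
  finally show ?thesis by simp
qed

text \<open>The rate at which the supersolution of \<open>error_bound\<close> must decay: enlarging \<open>S\<close> by three vertices
  multiplies \<open>exp (card S)\<close> by \<open>exp 3\<close>, and the extra 1 pays for all quadratic error terms.\<close>
definition \<kappa> :: real where "\<kappa> = exp 3 + 1"

lemma \<kappa>_pos: "0 < \<kappa>" by (simp add: \<kappa>_def add_pos_pos)

context regular_linear_hypergraph begin

text \<open>The idealised probability that a vertex is still free: if different vertices behaved
  independently, an edge would be accepted with probability \<open>U i ^ 4\<close>.\<close>
primrec U :: "nat \<Rightarrow> real" where
  "U 0 = 1"
| "U (Suc i) = U i - U i ^ 4 / real M"

lemma U_bounds: "0 \<le> U i \<and> U i \<le> 1"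
proof (induction i)
  case (Suc i)
  have "U i ^ 4 \<le> U i" using Suc power_decreasing[of 1 4 "U i"] by simp
  moreover have "U i ^ 4 / real M \<le> U i ^ 4"
    using M_pos Suc by (simp add: divide_le_eq mult_le_cancel_left1)
  moreover have "0 \<le> U i ^ 4 / real M" by simp
  ultimately show ?case using Suc unfolding U.simps by linarith
qed simp

lemma U_small:
  assumes "0 < \<delta>" "real M \<le> real k * \<delta> ^ 4"
  shows "U k \<le> \<delta>"
proof -
  have "U k \<le> \<delta> \<or> U k \<le> 1 - real k * \<delta> ^ 4 / real M" for k
  proof (induction k)
    case (Suc k)
    have 0: "0 \<le> U k ^ 4 / real M" by simp
    show ?case
    proof (cases "U k \<le> \<delta>")
      case True
      then have "U (Suc k) \<le> \<delta>" using 0 unfolding U.simps by linarith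
      then show ?thesis ..
    next
      case False
      then have "\<delta> ^ 4 / real M \<le> U k ^ 4 / real M"
        using assms by (intro divide_right_mono power_mono) auto
      moreover have "real (Suc k) * \<delta> ^ 4 / real M = real k * \<delta> ^ 4 / real M + \<delta> ^ 4 / real M"
        by (simp add: algebra_simps add_divide_distrib)
      ultimately have "U (Suc k) \<le> 1 - real (Suc k) * \<delta> ^ 4 / real M"
        using Suc False unfolding U.simps by linarith
      then show ?thesis ..
    qed
  qed simp
  moreover have "1 - real k * \<delta> ^ 4 / real M \<le> 0" using assms M_pos by (simp add: field_simps)
  ultimately show ?thesis using assms(1) by (smt (verit))
qed

text \<open>The size of vertex sets up to which the approximation is still meaningful at time \<open>i\<close>. It
  shrinks only by a constant factor as long as \<open>i\<close> is at most a constant multiple of \<open>M\<close>.\<close>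
definition L :: "real \<Rightarrow> nat \<Rightarrow> real" where
  "L L0 i = L0 * exp (- 2 * \<kappa> * real i / real M)"

lemma L_step:
  assumes "0 \<le> L0" "2 * \<kappa> \<le> real M"
  shows "L L0 (Suc i) + \<kappa> / real M * L L0 i \<le> L L0 i"
proof -
  have "L L0 (Suc i) = L L0 i * exp (- 2 * (\<kappa> / real M))"
  proof -
    have "- 2 * \<kappa> * real (Suc i) / real M = - 2 * \<kappa> * real i / real M + - 2 * (\<kappa> / real M)"
      by (simp add: algebra_simps add_divide_distrib diff_divide_distrib)
    then show ?thesis unfolding L_def by (simp only: exp_add mult.assoc)
  qed
  moreover have "\<kappa> / real M \<le> 1 - exp (- 2 * (\<kappa> / real M))"
    using assms \<kappa>_pos M_pos by (intro le_one_minus_exp) (auto simp: field_simps)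
  moreover have "0 \<le> L L0 i" using assms by (simp add: L_def)
  ultimately have "\<kappa> / real M * L L0 i \<le> L L0 i - L L0 (Suc i)"
    using mult_left_mono[of "\<kappa> / real M" "1 - exp (- 2 * (\<kappa> / real M))" "L L0 i"]
    by (simp add: algebra_simps)
  then show ?thesis by simp
qed

lemma L_le: "0 \<le> L0 \<Longrightarrow> L L0 i \<le> L0"
  unfolding L_def using \<kappa>_pos by (intro mult_left_le) auto

text \<open>The error for sets of size \<open>m\<close> grows at a rate governed by the error for sets of size \<open>m + 3\<close>, so
  the recurrence never closes. The bound \<open>exp (m - L i)\<close> is a supersolution of this hierarchy: for
  \<open>m \<ge> L i\<close> it exceeds 1 and is trivial, because both quantities are between 0 and 1; and for \<open>m < L i\<close>
  the decay of \<open>L\<close> outweighs the term of size \<open>m + 3\<close>.\<close>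
lemma error_bound:
  assumes L0: "0 \<le> L0" "5 * exp L0 \<le> real D" and M: "2 * \<kappa> \<le> real M" and "S \<subseteq> V"
  shows "\<bar>P S i - U i ^ card S\<bar> \<le> exp (real (card S) - L L0 i)"
  using \<open>S \<subseteq> V\<close>
proof (induction i arbitrary: S)
  case 0
  then show ?case by (simp add: P_0)
next
  case (Suc i S)
  let ?m = "card S" and ?L = "L L0 i" and ?L' = "L L0 (Suc i)" and ?u = "U i"
  let ?\<eta> = "exp (real ?m - ?L)"
  have finS: "finite S" using Suc.prems finV finite_subset by auto
  have step: "?L' + \<kappa> / real M * ?L \<le> ?L" by (rule L_step[OF L0(1) M])
  have L_nonneg: "0 \<le> ?L" using L0 by (simp add: L_def)
  then have L'L: "?L' \<le> ?L" using step \<kappa>_pos M_pos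
    by (smt (verit) divide_nonneg_nonneg mult_nonneg_nonneg of_nat_0_le_iff)
  consider "?m = 0" | "?L' \<le> real ?m" | "0 < ?m" "real ?m < ?L'" by linarith
  then show ?case
  proof cases
    case 1
    then have "S = {}" using finS by simp
    then show ?thesis by (simp add: P_empty)
  next
    case 2
    have "\<bar>P S (Suc i) - U (Suc i) ^ ?m\<bar> \<le> 1"
      using P_nonneg[of S "Suc i"] P_le_1[of S "Suc i"] U_bounds[of "Suc i"]
        power_le_one[of "U (Suc i)" ?m] zero_le_power[of "U (Suc i)" ?m] by (smt (verit))
    also have "1 \<le> exp (real ?m - ?L')" using 2 by simp
    finally show ?thesis .
  next
    case 3
    let ?s = "\<Sum>f\<in>{f \<in> E. vs f \<inter> S \<noteq> {}}. P (S \<union> vs f) i"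
    have u: "0 \<le> ?u" "?u \<le> 1" using U_bounds[of i] by auto
    have c: "real (card E) = real D * real M" by (simp add: cardE)
    have DM: "0 < real D" "0 < real M" "real D \<le> real M" using D_pos M_pos D_le_M by auto
    have shift: "exp (real (?m + 3) - ?L) = exp 3 * ?\<eta>"
      by (simp flip: exp_add)
    have hit: "\<bar>?s - real (?m * D) * ?u ^ (?m + 3)\<bar>
        \<le> real (?m * D) * (exp 3 * ?\<eta>) + 4 * real ?m ^ 2"
    proof (rule hitting_sum[OF Suc.prems])
      fix f assume f: "f \<in> E" "card (vs f \<inter> S) = 1"
      have "finite (vs f)" using vs_sub[OF f(1)] finV finite_subset by blast
      then have "card (S \<union> vs f) = ?m + 3"
        using card_Un_Int[OF finS, of "vs f"] card_vs[OF f(1)] f(2) by (simp add: Int_commute)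
      then show "\<bar>P (S \<union> vs f) i - ?u ^ (?m + 3)\<bar> \<le> exp 3 * ?\<eta>"
        using Suc.IH[of "S \<union> vs f"] Suc.prems vs_sub[OF f(1)] shift by simp
    qed (use u P_nonneg P_le_1 power_le_one in auto)
    have "?s / real (card E) - real ?m * ?u ^ (?m + 3) / real M
        = (?s - real (?m * D) * ?u ^ (?m + 3)) / (real D * real M)"
      unfolding c using DM by (simp add: diff_divide_distrib)
    then have "\<bar>?s / real (card E) - real ?m * ?u ^ (?m + 3) / real M\<bar>
        = \<bar>?s - real (?m * D) * ?u ^ (?m + 3)\<bar> / (real D * real M)"
      using DM by (simp only: abs_divide) simp
    also have "\<dots> \<le> (real (?m * D) * (exp 3 * ?\<eta>) + 4 * real ?m ^ 2) / (real D * real M)"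
      using hit DM by (intro divide_right_mono) auto
    also have "\<dots> = real ?m * exp 3 * ?\<eta> / real M + 4 * real ?m ^ 2 / (real D * real M)"
      using DM by (simp add: add_divide_distrib)
    finally have e1: "\<bar>?s / real (card E) - real ?m * ?u ^ (?m + 3) / real M\<bar>
        \<le> real ?m * exp 3 * ?\<eta> / real M + 4 * real ?m ^ 2 / (real D * real M)" .
    have e2: "\<bar>U (Suc i) ^ ?m - (?u ^ ?m - real ?m * ?u ^ (?m + 3) / real M)\<bar>
        \<le> real ?m ^ 2 / (real D * real M)"
    proof -
      define z where "z = ?u ^ 3 / real M"
      have u3: "0 \<le> ?u ^ 3" "?u ^ 3 \<le> 1" using u by (auto intro: power_le_one)
      have z: "0 \<le> z" "z \<le> 1 / real M" "z \<le> 1"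
        using u3 DM M_pos by (auto simp: z_def divide_le_eq intro!: divide_right_mono)
      have U': "U (Suc i) = ?u * (1 - z)"
        by (simp add: z_def algebra_simps power_numeral_reduce)
      have "U (Suc i) ^ ?m - (?u ^ ?m - real ?m * ?u ^ (?m + 3) / real M)
          = ?u ^ ?m * ((1 - z) ^ ?m - (1 - real ?m * z))"
        unfolding U' power_mult_distrib by (simp add: z_def algebra_simps power_add)
      then have "\<bar>U (Suc i) ^ ?m - (?u ^ ?m - real ?m * ?u ^ (?m + 3) / real M)\<bar>
          = ?u ^ ?m * \<bar>(1 - z) ^ ?m - (1 - real ?m * z)\<bar>"
        using u by (simp add: abs_mult)
      also have "\<dots> \<le> 1 * (real ?m * z)\<^sup>2"
        using u one_minus_power_approx[OF z(1,3), of ?m] by (intro mult_mono power_le_one) auto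
      also have "\<dots> \<le> (real ?m * (1 / real M))\<^sup>2"
        unfolding mult_1 using z by (intro power_mono mult_left_mono) auto
      also have "\<dots> = real ?m ^ 2 / (real M * real M)" by (simp add: power2_eq_square)
      also have "\<dots> \<le> real ?m ^ 2 / (real D * real M)"
        using DM by (intro divide_left_mono mult_right_mono) auto
      finally show ?thesis .
    qed
    have e3: "5 * real ?m ^ 2 / real D \<le> ?\<eta>"
    proof -
      have "5 * real ?m ^ 2 * exp ?L \<le> 5 * exp (real ?m) * exp L0"
        using square_le_exp[of "real ?m"] L_le[OF L0(1), of i] by (intro mult_mono) auto
      also have "\<dots> \<le> real D * exp (real ?m)" using mult_right_mono[OF L0(2), of "exp (real ?m)"]
        by (simp add: mult_ac)
      finally show ?thesis using DM by (simp add: exp_diff field_simps)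
    qed
    have "\<bar>P S (Suc i) - U (Suc i) ^ ?m\<bar> \<le> \<bar>P S i - ?u ^ ?m\<bar>
       + \<bar>?s / real (card E) - real ?m * ?u ^ (?m + 3) / real M\<bar>
       + \<bar>U (Suc i) ^ ?m - (?u ^ ?m - real ?m * ?u ^ (?m + 3) / real M)\<bar>"
    proof -
      have tri: "\<bar>a - s - u'\<bar> \<le> \<bar>a - b\<bar> + \<bar>s - t\<bar> + \<bar>u' - (b - t)\<bar>" for a s u' b t :: real
        by linarith
      show ?thesis unfolding P_Suc[of S] by (rule tri)
    qed
    also have "\<dots> \<le> ?\<eta> + (real ?m * exp 3 * ?\<eta> / real M + 4 * real ?m ^ 2 / (real D * real M))
       + real ?m ^ 2 / (real D * real M)"
      using Suc.IH[OF Suc.prems] e1 e2 by (intro add_mono)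
    also have "\<dots> = ?\<eta> + real ?m * exp 3 * ?\<eta> / real M + 5 * real ?m ^ 2 / real D / real M"
      by (simp add: divide_divide_eq_left)
    also have "\<dots> \<le> ?\<eta> + real ?m * exp 3 * ?\<eta> / real M + ?\<eta> / real M"
      using e3 DM by (intro add_left_mono divide_right_mono) auto
    also have "\<dots> = ?\<eta> * (1 + (real ?m * exp 3 + 1) / real M)"
      by (simp add: algebra_simps add_divide_distrib)
    also have "\<dots> \<le> ?\<eta> * (1 + \<kappa> * ?L / real M)"
    proof -
      have "real ?m * exp 3 + 1 \<le> real ?m * \<kappa>" using 3 by (simp add: \<kappa>_def algebra_simps)
      also have "\<dots> \<le> ?L * \<kappa>" using 3 L'L \<kappa>_pos by (intro mult_right_mono) auto
      finally show ?thesis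
        using DM by (intro mult_left_mono add_left_mono divide_right_mono) (auto simp: mult.commute)
    qed
    also have "\<dots> \<le> ?\<eta> * exp (?L - ?L')"
    proof (rule mult_left_mono)
      have "1 + \<kappa> * ?L / real M \<le> 1 + (?L - ?L')" using step by simp
      also have "\<dots> \<le> exp (?L - ?L')" by (rule exp_ge_add_one_self)
      finally show "1 + \<kappa> * ?L / real M \<le> exp (?L - ?L')" .
    qed simp
    also have "\<dots> = exp (real ?m - ?L')" by (simp flip: exp_add)
    finally show ?thesis .
  qed
qed

definition matchings :: "'e set set" where
  "matchings = {G. G \<subseteq> E \<and> (\<forall>e\<in>G. \<forall>f\<in>G. e \<noteq> f \<longrightarrow> vs e \<inter> vs f = {})}"

lemma greedy_matching: "set w \<subseteq> E \<Longrightarrow> greedy vs w \<in> matchings"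
  unfolding matchings_def using greedy_subset[of vs w] greedy_disjoint[of _ vs w] by auto

lemma card_covered:
  assumes "set w \<subseteq> E"
  shows "card (covered w) = 4 * card (greedy vs w)"
proof -
  have "greedy vs w \<subseteq> E" using greedy_subset[of vs w] assms by blast
  moreover have "finite (vs e)" if "e \<in> E" for e using vs_sub[OF that] finV finite_subset by blast
  moreover have "finite (greedy vs w)" by (rule finite_subset[OF greedy_subset finite_set])
  ultimately have "card (covered w) = (\<Sum>e\<in>greedy vs w. card (vs e))"
    unfolding covered_def using greedy_disjoint[of _ vs w] by (intro card_UN_disjoint) auto
  also have "\<dots> = (\<Sum>e\<in>greedy vs w. 4)"
    using card_vs \<open>greedy vs w \<subseteq> E\<close> by (intro sum.cong) auto
  finally show ?thesis by simp
qed

text \<open>By \<open>error_bound\<close> the expected proportion of free vertices is at most \<open>\<delta> / 2\<close> after \<open>T * M\<close> draws, so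
  at least half of the words give a matching of the required size. Each such matching is given by at
  most a proportion \<open>(T / D) ^ card G\<close> of the words.\<close>
theorem many_near_perfect_matchings:
  assumes \<delta>: "0 < \<delta>" "\<delta> \<le> 1" and T: "1 \<le> T" "1 \<le> real T * (\<delta> / 4) ^ 4"
    and L0: "0 \<le> L0" "1 + ln (4 / \<delta>) \<le> L0 * exp (- 2 * \<kappa> * real T)"
    and D: "5 * exp L0 \<le> real D" "2 * \<kappa> \<le> real D" "T \<le> D"
  shows "1 / 2 * (real D / real T) powr ((1 - \<delta>) * real M)
     \<le> real (card {G \<in> matchings. (1 - \<delta>) * real M \<le> real (card G)})"
proof -
  define l where "l = T * M"
  define c where "c = real (card E)"
  define W where "W = words l"
  define MS where "MS = {G \<in> matchings. (1 - \<delta>) * real M \<le> real (card G)}"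
  define good where "good = {w \<in> W. (1 - \<delta>) * real M \<le> real (card (greedy vs w))}"
  have c0: "0 < c" using cardE_pos by (simp add: c_def)
  have M0: "0 < real M" using M_pos by simp
  have finW: "finite W" by (simp add: W_def finite_words)
  have WE: "set w \<subseteq> E" if "w \<in> W" for w using that by (simp add: W_def words_def)
  have cardW: "real (card W) = c ^ l" by (simp add: W_def card_words c_def)
  have finMS: "finite MS"
    unfolding MS_def matchings_def by (rule finite_subset[of _ "Pow E"]) (use finE in auto)
  have vertex: "P {v} l \<le> \<delta> / 2" if "v \<in> V" for v
  proof -
    have "P {v} l \<le> U l + exp (1 - L L0 l)"
      using error_bound[OF L0(1) D(1), of "{v}" l] that D D_le_M by simp
    moreover have "U l \<le> \<delta> / 4"
    proof (rule U_small)
      have "real M * 1 \<le> real M * (real T * (\<delta> / 4) ^ 4)" using T by (intro mult_left_mono) auto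
      then show "real M \<le> real l * (\<delta> / 4) ^ 4" by (simp add: l_def algebra_simps)
    qed (use \<delta> in simp)
    moreover have "exp (1 - L L0 l) \<le> \<delta> / 4"
    proof -
      have "L L0 l = L0 * exp (- 2 * \<kappa> * real T)" using M0 by (simp add: L_def l_def)
      then have "1 - L L0 l \<le> - ln (4 / \<delta>)" using L0 by linarith
      also have "- ln (4 / \<delta>) = ln (\<delta> / 4)" using \<delta> by (simp add: ln_div)
      finally have "exp (1 - L L0 l) \<le> exp (ln (\<delta> / 4))" by simp
      then show ?thesis using \<delta> by simp
    qed
    ultimately show ?thesis by linarith
  qed
  have total: "(\<Sum>w\<in>W. real (card (V - covered w))) \<le> 2 * \<delta> * real M * c ^ l"
  proof -
    have "(\<Sum>w\<in>W. real (card (V - covered w))) = (\<Sum>w\<in>W. \<Sum>v\<in>V. if v \<notin> covered w then 1 else 0)"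
      using finV by (intro sum.cong refl) (simp add: sum.If_cases set_diff_eq Int_def)
    also have "\<dots> = (\<Sum>v\<in>V. \<Sum>w\<in>W. if v \<notin> covered w then 1 else 0)" by (rule sum.swap)
    also have "\<dots> = (\<Sum>v\<in>V. real (cnt {v} l))"
      using finW by (intro sum.cong refl) (simp add: sum.If_cases cnt_def W_def Int_def)
    also have "\<dots> = (\<Sum>v\<in>V. P {v} l * c ^ l)"
      using c0 by (intro sum.cong refl) (simp add: P_def c_def)
    also have "\<dots> \<le> (\<Sum>v\<in>V. \<delta> / 2 * c ^ l)"
      using vertex c0 by (intro sum_mono mult_right_mono) auto
    also have "\<dots> = 2 * \<delta> * real M * c ^ l" by (simp add: cardV)
    finally show ?thesis .
  qed
  have half: "c ^ l / 2 \<le> real (card good)"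
  proof -
    have "4 * \<delta> * real M \<le> real (card (V - covered w))" if "w \<in> W - good" for w
    proof -
      have w: "set w \<subseteq> E" using that WE by blast
      have "covered w \<subseteq> V" using greedy_subset[of vs w] w vs_sub by (fastforce simp: covered_def)
      then have "real (card (V - covered w)) = 4 * real M - 4 * real (card (greedy vs w))"
        using card_covered[OF w] cardV finV
        by (metis card_Diff_subset card_mono finite_subset of_nat_diff of_nat_mult of_nat_numeral)
      moreover have "real (card (greedy vs w)) < (1 - \<delta>) * real M" using that by (auto simp: good_def)
      ultimately show ?thesis by (simp add: algebra_simps)
    qed
    then have "(\<Sum>w\<in>W - good. 4 * \<delta> * real M) \<le> (\<Sum>w\<in>W - good. real (card (V - covered w)))"
      by (intro sum_mono)
    also have "\<dots> \<le> (\<Sum>w\<in>W. real (card (V - covered w)))"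
      using finW by (intro sum_mono2) auto
    also note total
    finally have "real (card (W - good)) * (4 * \<delta> * real M) \<le> 2 * \<delta> * real M * c ^ l"
      unfolding sum_constant .
    then have "real (card (W - good)) \<le> c ^ l / 2" using \<delta> M0 by (simp add: field_simps)
    moreover have "card (W - good) = card W - card good"
      using finW by (intro card_Diff_subset) (auto simp: good_def)
    moreover have "card good \<le> card W" using finW by (intro card_mono) (auto simp: good_def)
    ultimately show ?thesis using cardW by (simp add: of_nat_diff)
  qed
  have ratio: "real l / c = real T / real D"
    using M0 by (simp add: l_def c_def cardE)
  define q where "q = (real T / real D) powr ((1 - \<delta>) * real M)"
  have TD: "0 < real T / real D" "real T / real D \<le> 1" using T D by auto
  have q0: "0 < q" using T D_pos by (simp add: q_def)
  have "good \<subseteq> (\<Union>G\<in>MS. {w. set w \<subseteq> E \<and> length w = l \<and> G \<subseteq> set w})"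
  proof
    fix w assume w: "w \<in> good"
    then have "greedy vs w \<in> MS" using greedy_matching WE by (auto simp: good_def MS_def)
    then show "w \<in> (\<Union>G\<in>MS. {w. set w \<subseteq> E \<and> length w = l \<and> G \<subseteq> set w})"
      using w greedy_subset[of vs w] by (auto simp: good_def W_def words_def)
  qed
  then have "card good \<le> card (\<Union>G\<in>MS. {w. set w \<subseteq> E \<and> length w = l \<and> G \<subseteq> set w})"
    using finMS finite_words[of l] by (intro card_mono finite_UN_I) (auto simp: words_def elim: finite_subset[rotated])
  also have "\<dots> \<le> (\<Sum>G\<in>MS. card {w. set w \<subseteq> E \<and> length w = l \<and> G \<subseteq> set w})"
    by (rule card_UN_le[OF finMS])
  finally have "real (card good) \<le> (\<Sum>G\<in>MS. real (card {w. set w \<subseteq> E \<and> length w = l \<and> G \<subseteq> set w}))"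
    by (simp flip: of_nat_sum)
  also have "\<dots> \<le> (\<Sum>G\<in>MS. q * c ^ l)"
  proof (rule sum_mono)
    fix G assume G: "G \<in> MS"
    have "finite G" "E \<noteq> {}" using G finE cardE_pos by (auto simp: MS_def matchings_def elim: finite_subset)
    then have "real (card {w. set w \<subseteq> E \<and> length w = l \<and> G \<subseteq> set w}) \<le> (real T / real D) ^ card G * c ^ l"
      using card_words_containing[OF finE, of G l] ratio by (simp add: c_def)
    also have "(real T / real D) ^ card G = (real T / real D) powr real (card G)"
      using TD by (simp add: powr_realpow)
    also have "\<dots> \<le> q"
      unfolding q_def using G TD by (intro powr_mono') (auto simp: MS_def)
    finally show "real (card {w. set w \<subseteq> E \<and> length w = l \<and> G \<subseteq> set w}) \<le> q * c ^ l"
      using c0 by (simp add: mult_right_mono)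
  qed
  finally have "c ^ l * (1 / 2) \<le> c ^ l * (real (card MS) * q)" using half by (simp add: mult_ac)
  then have "1 / 2 \<le> real (card MS) * q" using c0 by (simp del: mult_cancel_left)
  then have "1 / 2 * (1 / q) \<le> real (card MS)" using q0 by (simp add: field_simps)
  also have "1 / q = (real D / real T) powr ((1 - \<delta>) * real M)"
    unfolding q_def using TD by (simp add: powr_divide)
  finally show ?thesis by (simp add: MS_def)
qed

end

section \<open>Non-attacking sets of queens\<close>

definition attack :: "int \<times> int \<Rightarrow> int \<times> int \<Rightarrow> bool" where
  "attack a b \<longleftrightarrow> fst a = fst b \<or> snd a = snd b \<or>
     fst a + snd a = fst b + snd b \<or> fst a - snd a = fst b - snd b"

definition non_attacking :: "(int \<times> int) set \<Rightarrow> bool" where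
  "non_attacking Q \<longleftrightarrow> (\<forall>a\<in>Q. \<forall>b\<in>Q. a \<noteq> b \<longrightarrow> \<not> attack a b)"

lemma attack_sym: "attack a b \<Longrightarrow> attack b a" by (auto simp: attack_def)

lemma non_attackingD: "non_attacking Q \<Longrightarrow> a \<in> Q \<Longrightarrow> b \<in> Q \<Longrightarrow> attack a b \<Longrightarrow> a = b"
  unfolding non_attacking_def by blast

lemma non_attacking_subset: "non_attacking Q \<Longrightarrow> R \<subseteq> Q \<Longrightarrow> non_attacking R"
  unfolding non_attacking_def by blast

lemma non_attacking_Un:
  assumes "non_attacking A" "non_attacking B" "\<And>a b. a \<in> A \<Longrightarrow> b \<in> B \<Longrightarrow> \<not> attack a b"
  shows "non_attacking (A \<union> B)"
  unfolding non_attacking_def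
proof (intro ballI impI)
  fix a b assume "a \<in> A \<union> B" "b \<in> A \<union> B" "a \<noteq> b"
  then show "\<not> attack a b"
    using assms(3)[of a b] assms(3)[of b a] attack_sym[of a b]
      non_attackingD[OF assms(1), of a b] non_attackingD[OF assms(2), of a b] by (elim UnE) auto
qed

lemma non_attacking_insert:
  assumes "non_attacking A" "\<And>b. b \<in> A \<Longrightarrow> \<not> attack a b"
  shows "non_attacking (insert a A)"
  using non_attacking_Un[of "{a}" A] assms by (simp add: non_attacking_def)

lemma non_attacking_inj:
  assumes "non_attacking Q"
  shows "inj_on fst Q" "inj_on snd Q" "inj_on (\<lambda>c. fst c + snd c) Q" "inj_on (\<lambda>c. fst c - snd c) Q"
  by (intro inj_onI, rule non_attackingD[OF assms]; simp add: attack_def)+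

lemma queens_configuration_iff:
  "queens_configuration n Q \<longleftrightarrow> Q \<subseteq> board n \<and> card Q = n \<and> non_attacking Q"
proof -
  have "(\<forall>L \<in> rows n \<union> columns n \<union> diagonals n. card (Q \<inter> L) \<le> 1) \<longleftrightarrow> non_attacking Q"
    if Q: "Q \<subseteq> board n"
  proof -
    have fin: "finite (Q \<inter> L)" for L
      by (rule finite_subset[of _ "board n"]) (use Q in \<open>auto simp: board_def\<close>)
    have le1: "card (Q \<inter> L) \<le> 1 \<longleftrightarrow> (\<forall>a\<in>Q \<inter> L. \<forall>b\<in>Q \<inter> L. a = b)" for L
      using card_le_Suc0_iff_eq[OF fin] by simp
    show ?thesis
    proof
      assume na: "non_attacking Q"
      show "\<forall>L \<in> rows n \<union> columns n \<union> diagonals n. card (Q \<inter> L) \<le> 1"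
      proof
        fix L assume "L \<in> rows n \<union> columns n \<union> diagonals n"
        then have "attack a b" if "a \<in> L" "b \<in> L" for a b
          using that unfolding rows_def columns_def diagonals_def attack_def by auto
        then show "card (Q \<inter> L) \<le> 1" unfolding le1 using non_attackingD[OF na] by blast
      qed
    next
      assume H: "\<forall>L \<in> rows n \<union> columns n \<union> diagonals n. card (Q \<inter> L) \<le> 1"
      show "non_attacking Q" unfolding non_attacking_def
      proof (intro ballI impI notI)
        fix a b assume ab: "a \<in> Q" "b \<in> Q" "a \<noteq> b" "attack a b"
        have bd: "a \<in> board n" "b \<in> board n" using ab Q by auto
        have "\<exists>L \<in> rows n \<union> columns n \<union> diagonals n. a \<in> L \<and> b \<in> L"
        proof -
          consider "fst a = fst b" | "snd a = snd b" | "fst a + snd a = fst b + snd b"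
            | "fst a - snd a = fst b - snd b" using ab(4) by (auto simp: attack_def)
          then show ?thesis
          proof cases
            case 1
            let ?L = "{(x, y) \<in> board n. x = fst a}"
            have L: "?L \<in> columns n"
              unfolding columns_def mem_Collect_eq
              by (rule exI[of _ "fst a"]) (use bd in \<open>simp add: board_def mem_Times_iff\<close>)
            have "a \<in> ?L" "b \<in> ?L" using bd 1 by (cases a; cases b; simp)+
            then show ?thesis by (intro bexI[OF _ UnI1[OF UnI2[OF L]]] conjI)
          next
            case 2
            let ?L = "{(x, y) \<in> board n. y = snd a}"
            have L: "?L \<in> rows n"
              unfolding rows_def mem_Collect_eq
              by (rule exI[of _ "snd a"]) (use bd in \<open>simp add: board_def mem_Times_iff\<close>)
            have "a \<in> ?L" "b \<in> ?L" using bd 2 by (cases a; cases b; simp)+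
            then show ?thesis by (intro bexI[OF _ UnI1[OF UnI1[OF L]]] conjI)
          next
            case 3
            let ?L = "{(x, y) \<in> board n. x + y = fst a + snd a}"
            have L: "?L \<in> diagonals n" unfolding diagonals_def by blast
            have "a \<in> ?L" "b \<in> ?L" using bd 3 by (cases a; cases b; simp)+
            then show ?thesis by (intro bexI[OF _ UnI2[OF L]] conjI)
          next
            case 4
            let ?L = "{(x, y) \<in> board n. x - y = fst a - snd a}"
            have L: "?L \<in> diagonals n" unfolding diagonals_def by blast
            have "a \<in> ?L" "b \<in> ?L" using bd 4 by (cases a; cases b; simp)+
            then show ?thesis by (intro bexI[OF _ UnI2[OF L]] conjI)
          qed
        qed
        then show False using H ab unfolding le1 by blast
      qed
    qed
  qed
  then show ?thesis unfolding queens_configuration_def by blast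
qed

lemma card_residue_class:
  fixes a m \<xi> :: int
  assumes "0 < m"
  shows "card {x \<in> {a..<a + m * int K}. m dvd x - \<xi>} = K"
proof -
  define x0 where "x0 = a + (\<xi> - a) mod m"
  have x0: "a \<le> x0" "x0 < a + m" "m dvd x0 - \<xi>"
  proof -
    have "x0 - \<xi> = - (m * ((\<xi> - a) div m))"
      unfolding x0_def minus_mult_div_eq_mod[symmetric] by simp
    then show "m dvd x0 - \<xi>" by simp
    show "a \<le> x0" "x0 < a + m" using assms by (simp_all add: x0_def)
  qed
  have "{x \<in> {a..<a + m * int K}. m dvd x - \<xi>} = (\<lambda>i. x0 + m * int i) ` {..<K}"
  proof (intro equalityI subsetI)
    fix x assume x: "x \<in> {x \<in> {a..<a + m * int K}. m dvd x - \<xi>}"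
    have "m dvd (x - \<xi>) - (x0 - \<xi>)" by (rule dvd_diff) (use x x0 in auto)
    then obtain i where i: "x - x0 = m * i" by (auto elim: dvdE)
    have "0 \<le> i"
    proof (rule ccontr)
      assume "\<not> 0 \<le> i"
      then have "m * i \<le> m * (- 1)" using assms by (intro mult_left_mono) auto
      then show False using i x x0 by auto
    qed
    moreover have "i < int K"
    proof (rule ccontr)
      assume "\<not> i < int K"
      then have "m * int K \<le> m * i" using assms by (intro mult_left_mono) auto
      moreover have "x < a + m * int K" using x by simp
      ultimately show False using i x0 by linarith
    qed
    ultimately have "x = x0 + m * int (nat i)" "nat i < K" using i by auto
    then show "x \<in> (\<lambda>i. x0 + m * int i) ` {..<K}" by blast
  next
    fix x assume "x \<in> (\<lambda>i. x0 + m * int i) ` {..<K}"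
    then obtain i where i: "i < K" "x = x0 + m * int i" by blast
    have "m * (int i + 1) \<le> m * int K" using i assms by (intro mult_left_mono) auto
    then have "x < a + m * int K" using i x0 by (simp add: algebra_simps)
    moreover have "a \<le> x" using i x0 assms by (simp add: add_increasing2)
    moreover have "m dvd x - \<xi>"
      using i dvd_add[OF x0(3), of "m * int i"] by (simp add: algebra_simps)
    ultimately show "x \<in> {x \<in> {a..<a + m * int K}. m dvd x - \<xi>}" by simp
  qed
  moreover have "inj_on (\<lambda>i. x0 + m * int i) {..<K}" using assms by (auto simp: inj_on_def)
  ultimately show ?thesis by (simp add: card_image)
qed

lemma ex_representative:
  fixes N z :: int
  assumes "0 < N"
  shows "\<exists>y\<in>{1..N}. N dvd y - z"
proof
  show "N dvd ((z - 1) mod N + 1) - z"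
    using mod_eq_dvd_iff[of "(z - 1) mod N" N "z - 1"] by (simp add: algebra_simps)
  show "(z - 1) mod N + 1 \<in> {1..N}"
    using assms pos_mod_bound[of N "z - 1"] by (simp add: zless_imp_add1_zle)
qed

lemma ex_solution:
  fixes N a z :: int
  assumes "0 < N" "coprime a N"
  shows "\<exists>x\<in>{1..N}. N dvd z - a * x"
proof -
  obtain b where "[a * b = 1] (mod N)" using cong_solve_coprime_int[OF assms(2)] by blast
  then have b: "N dvd a * b - 1" by (simp add: cong_iff_dvd_diff)
  obtain x where x: "x \<in> {1..N}" "N dvd x - b * z" using ex_representative[OF assms(1)] by blast
  have "z - a * x = - (z * (a * b - 1)) - a * (x - b * z)" by (simp add: algebra_simps)
  also have "N dvd \<dots>" using dvd_mult[OF b, of z] dvd_mult[OF x(2), of a] by (intro dvd_diff) auto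
  finally show ?thesis using x by blast
qed

lemma eq_if_dvd_diff:
  fixes N x y :: int
  assumes "x \<in> {1..N}" "y \<in> {1..N}" "N dvd x - y"
  shows "x = y"
proof (rule ccontr)
  assume "x \<noteq> y"
  then have "\<bar>N\<bar> \<le> \<bar>x - y\<bar>" using assms(3) by (intro dvd_imp_le_int) auto
  then show False using assms(1,2) by auto
qed

lemma int_chinese_remainder:
  fixes m :: "'i \<Rightarrow> nat" and u :: "'i \<Rightarrow> int"
  assumes fin: "finite A" and pos: "\<And>i. i \<in> A \<Longrightarrow> 0 < m i"
    and cop: "\<And>i j. i \<in> A \<Longrightarrow> j \<in> A \<Longrightarrow> i \<noteq> j \<Longrightarrow> coprime (m i) (m j)"
  shows "\<exists>x. \<forall>i\<in>A. int (m i) dvd x - u i"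
proof -
  obtain x where x: "\<forall>i\<in>A. [x = nat (u i mod int (m i))] (mod m i)"
    using chinese_remainder_nat[OF fin, of m "\<lambda>i. nat (u i mod int (m i))"] cop by blast
  have "int (m i) dvd int x - u i" if "i \<in> A" for i
  proof -
    have "[int x = int (nat (u i mod int (m i)))] (mod int (m i))"
      unfolding cong_int_iff using x that by blast
    then have "[int x = u i mod int (m i)] (mod int (m i))"
      using pos[OF that] pos_mod_sign[of "int (m i)" "u i"] by simp
    then have "[int x = u i] (mod int (m i))" by (simp add: cong_def)
    then show ?thesis by (simp add: cong_iff_dvd_diff)
  qed
  then show ?thesis by blast
qed

text \<open>The column, the row and the diagonals of a point of the line of slope \<open>a\<close> on the torus are its first
  coordinate times 1, \<open>a\<close>, \<open>1 + a\<close> and \<open>1 - a\<close>, all of them units.\<close>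
lemma non_attacking_line:
  fixes N a :: int
  assumes S: "\<And>x y. (x, y) \<in> S \<Longrightarrow> x \<in> {1..N} \<and> y \<in> {1..N} \<and> N dvd y - a * x"
    and cop: "coprime N a" "coprime N (a + 1)" "coprime N (a - 1)"
  shows "non_attacking S"
  unfolding non_attacking_def
proof (intro ballI impI notI)
  fix c d assume "c \<in> S" "d \<in> S" "c \<noteq> d" and att: "attack c d"
  obtain x y x' y' where cd: "c = (x, y)" "d = (x', y')" by (cases c, cases d) auto
  have r: "x \<in> {1..N}" "y \<in> {1..N}" "x' \<in> {1..N}" "y' \<in> {1..N}"
    and d: "N dvd y - a * x" "N dvd y' - a * x'"
    using S \<open>c \<in> S\<close> \<open>d \<in> S\<close> cd by auto
  have dd: "N dvd (y - a * x) - (y' - a * x')" using d by (rule dvd_diff)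
  have "N dvd x - x'"
    using att unfolding attack_def cd fst_conv snd_conv
  proof (elim disjE)
    assume "y = y'"
    then have "N dvd a * (x' - x)" using dd by (simp add: algebra_simps)
    then have "N dvd x' - x" using cop(1) by (simp add: coprime_dvd_mult_right_iff)
    then show ?thesis by (simp add: dvd_diff_commute)
  next
    assume "x + y = x' + y'"
    then have "(y - a * x) - (y' - a * x') = (a + 1) * (x' - x)" by (simp add: algebra_simps)
    then have "N dvd x' - x" using cop(2) dd by (simp add: coprime_dvd_mult_right_iff)
    then show ?thesis by (simp add: dvd_diff_commute)
  next
    assume "x - y = x' - y'"
    then have "(y - a * x) - (y' - a * x') = (a - 1) * (x' - x)" by (simp add: algebra_simps)
    then have "N dvd x' - x" using cop(3) dd by (simp add: coprime_dvd_mult_right_iff)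
    then show ?thesis by (simp add: dvd_diff_commute)
  qed simp
  then have "x = x'" using r eq_if_dvd_diff by blast
  then have "N dvd y - y'" using dd by simp
  then have "y = y'" using r eq_if_dvd_diff by blast
  then show False using \<open>x = x'\<close> \<open>c \<noteq> d\<close> cd by simp
qed

section \<open>The reserved structure and the switchings\<close>

text \<open>The primes are too large to divide 2, 3, 4, 23, 24 or 25, which are the slopes 3 and 24 and
  their neighbours; and \<open>690 = 2 * 3 * 5 * 23\<close> makes the same numbers units modulo \<open>N\<close>.\<close>
locale absorber =
  fixes p :: "nat \<Rightarrow> nat" and N :: int
  assumes p_prime: "t \<in> {1..5} \<Longrightarrow> prime (p t)" and p_gt: "t \<in> {1..5} \<Longrightarrow> 23 < p t"
    and p_inj: "inj_on p {1..5}"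
    and N_pos: "0 < N" and p_dvd: "t \<in> {1..5} \<Longrightarrow> int (p t) dvd N"
    and N_cop: "coprime N 690"
begin

definition m :: int where "m = (\<Prod>t\<in>{1..5}. int (p t))"

definition regular :: "int \<Rightarrow> bool" where "regular x \<longleftrightarrow> (\<forall>t\<in>{1..5}. \<not> int (p t) dvd x)"

definition switchable :: "(int \<times> int) set" where
  "switchable = {(x, y). x \<in> {1..N} \<and> y \<in> {1..N} \<and> int (p 1) dvd x \<and> N dvd y - 24 * x}"

definition filler :: "(int \<times> int) set" where
  "filler = {(x, y). x \<in> {1..N} \<and> y \<in> {1..N} \<and> \<not> int (p 1) dvd x \<and> \<not> regular x \<and> N dvd y - 3 * x}"

definition cells :: "(int \<times> int) set" where
  "cells = {(x, y). x \<in> {1..N} \<and> y \<in> {1..N} \<and> regular x \<and> m dvd y - 3 * x}"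

lemma p_dvd_m: "t \<in> {1..5} \<Longrightarrow> int (p t) dvd m"
  unfolding m_def using dvd_prodI[of "{1..5}" t "\<lambda>t. int (p t)"] by simp

lemma m_pos: "0 < m"
  unfolding m_def using p_gt by (intro prod_pos) fastforce

lemma coprime_factors:
  assumes "d dvd 690" shows "coprime N d"
  using coprime_divisors[OF dvd_refl assms N_cop] .

lemma N_coprime: "coprime N 2" "coprime N 3" "coprime N 4" "coprime N 23" "coprime N 24" "coprime N 25"
proof -
  have b: "coprime N 2" "coprime N 3" "coprime N 5" "coprime N 23"
    by (rule coprime_factors; simp)+
  then show "coprime N 2" "coprime N 3" "coprime N 23" by auto
  have "coprime N (2 * 2)" "coprime N (2 * 2 * 2 * 3)" "coprime N (5 * 5)"
    using b by (simp_all only: coprime_mult_right_iff simp_thms)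
  then show "coprime N 4" "coprime N 24" "coprime N 25" by auto
qed

lemma N_odd: "odd N"
  using N_coprime(1) by simp

lemma prime_not_dvd:
  assumes "t \<in> {1..5}" "k \<in> {2, 3, 4, 23, 24, 25}" shows "coprime (int (p t)) k"
proof -
  have "coprime N k" using assms(2) N_coprime by auto
  then show ?thesis by (rule coprime_divisors[OF p_dvd[OF assms(1)] dvd_refl])
qed

text \<open>This is what separates the three families of queens: a prime dividing one line through a
  square divides all four, so queens of different families never attack each other.\<close>
lemma divisibility_on_line:
  assumes t: "t \<in> {1..5}" and a: "a \<in> {3, 24}" and d: "int (p t) dvd y - a * x"
  shows "int (p t) dvd y \<longleftrightarrow> int (p t) dvd x"
    and "int (p t) dvd x + y \<longleftrightarrow> int (p t) dvd x"
    and "int (p t) dvd x - y \<longleftrightarrow> int (p t) dvd x"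
proof -
  let ?q = "int (p t)"
  have c: "coprime ?q a" "coprime ?q (a + 1)" "coprime ?q (a - 1)"
    using a prime_not_dvd[OF t, of 2] prime_not_dvd[OF t, of 3] prime_not_dvd[OF t, of 4]
      prime_not_dvd[OF t, of 23] prime_not_dvd[OF t, of 24] prime_not_dvd[OF t, of 25] by auto
  have "?q dvd y \<longleftrightarrow> ?q dvd y - (y - a * x)" using d by (metis dvd_diff_left_iff)
  then show "?q dvd y \<longleftrightarrow> ?q dvd x" using c by (simp add: coprime_dvd_mult_right_iff)
  have "?q dvd x + y \<longleftrightarrow> ?q dvd (x + y) - (y - a * x)" using d by (metis dvd_diff_left_iff)
  also have "(x + y) - (y - a * x) = (a + 1) * x" by (simp add: algebra_simps)
  finally show "?q dvd x + y \<longleftrightarrow> ?q dvd x" using c by (simp add: coprime_dvd_mult_right_iff)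
  have "?q dvd x - y \<longleftrightarrow> ?q dvd (x - y) + (y - a * x)" using d by (metis dvd_add_left_iff)
  also have "(x - y) + (y - a * x) = - ((a - 1) * x)" by (simp add: algebra_simps)
  finally show "?q dvd x - y \<longleftrightarrow> ?q dvd x" using c by (simp add: coprime_dvd_mult_right_iff)
qed

lemma divisibility:
  assumes t: "t \<in> {1..5}" and c: "c \<in> cells \<union> switchable \<union> filler"
  shows "int (p t) dvd snd c \<longleftrightarrow> int (p t) dvd fst c"
    and "int (p t) dvd fst c + snd c \<longleftrightarrow> int (p t) dvd fst c"
    and "int (p t) dvd fst c - snd c \<longleftrightarrow> int (p t) dvd fst c"
proof -
  obtain a where a: "a \<in> {3, 24}" "int (p t) dvd snd c - a * fst c"
    using c p_dvd[OF t] p_dvd_m[OF t] unfolding cells_def switchable_def filler_def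
    by (cases c) (auto intro: dvd_trans)
  show "int (p t) dvd snd c \<longleftrightarrow> int (p t) dvd fst c"
    "int (p t) dvd fst c + snd c \<longleftrightarrow> int (p t) dvd fst c"
    "int (p t) dvd fst c - snd c \<longleftrightarrow> int (p t) dvd fst c"
    using divisibility_on_line[OF t a] by auto
qed

lemma attack_same_divisors:
  assumes "c \<in> cells \<union> switchable \<union> filler" "d \<in> cells \<union> switchable \<union> filler" "attack c d" "t \<in> {1..5}"
  shows "int (p t) dvd fst c \<longleftrightarrow> int (p t) dvd fst d"
proof -
  note c = divisibility[OF assms(4,1)] and d = divisibility[OF assms(4,2)]
  show ?thesis using assms(3) unfolding attack_def
  proof (elim disjE)
    assume "snd c = snd d" then show ?thesis using c(1) d(1) by simp
  next
    assume "fst c + snd c = fst d + snd d" then show ?thesis using c(2) d(2) by simp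
  next
    assume "fst c - snd c = fst d - snd d" then show ?thesis using c(3) d(3) by simp
  qed simp
qed

lemma non_attacking_switchable: "non_attacking switchable"
  by (rule non_attacking_line[of _ N 24]) (use N_coprime in \<open>auto simp: switchable_def\<close>)

lemma non_attacking_filler: "non_attacking filler"
  by (rule non_attacking_line[of _ N 3]) (use N_coprime in \<open>auto simp: filler_def\<close>)

lemma switchable_fst: "c \<in> switchable \<Longrightarrow> int (p 1) dvd fst c" by (auto simp: switchable_def)
lemma filler_fst: "c \<in> filler \<Longrightarrow> \<not> int (p 1) dvd fst c \<and> \<not> regular (fst c)" by (auto simp: filler_def)
lemma cells_fst: "c \<in> cells \<Longrightarrow> regular (fst c)" by (auto simp: cells_def)

lemma switchable_filler_apart: "c \<in> switchable \<Longrightarrow> d \<in> filler \<Longrightarrow> \<not> attack c d"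
  using attack_same_divisors[of c d 1] switchable_fst[of c] filler_fst[of d] by auto

lemma cells_apart: "c \<in> cells \<Longrightarrow> d \<in> switchable \<union> filler \<Longrightarrow> \<not> attack c d"
proof
  assume "c \<in> cells" "d \<in> switchable \<union> filler" "attack c d"
  then have "regular (fst c)" "\<not> regular (fst d)" "\<And>t. t \<in> {1..5} \<Longrightarrow> int (p t) dvd fst c \<longleftrightarrow> int (p t) dvd fst d"
    using attack_same_divisors[of c d] switchable_fst[of d] filler_fst[of d] cells_fst[of c]
    unfolding regular_def by auto
  then show False unfolding regular_def by blast
qed

lemma non_attacking_core:
  assumes "P \<subseteq> cells" "non_attacking P"
  shows "non_attacking (P \<union> switchable \<union> filler)"
proof (rule non_attacking_Un[OF non_attacking_Un[OF assms(2) non_attacking_switchable] non_attacking_filler])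
  show "\<not> attack a b" if "a \<in> P" "b \<in> switchable" for a b using that assms(1) cells_apart[of a b] by auto
  show "\<not> attack a b" if "a \<in> P \<union> switchable" "b \<in> filler" for a b
    using that assms(1) cells_apart[of a b] switchable_filler_apart[of a b] by auto
qed

lemma covers_irregular:
  assumes "z \<in> {1..N}" "\<not> regular z"
  shows "z \<in> fst ` (switchable \<union> filler)" and "z \<in> snd ` (switchable \<union> filler)"
proof -
  obtain y where y: "y \<in> {1..N}" "N dvd y - 24 * z" using ex_representative[OF N_pos] by blast
  obtain y' where y': "y' \<in> {1..N}" "N dvd y' - 3 * z" using ex_representative[OF N_pos] by blast
  have "(z, y) \<in> switchable \<or> (z, y') \<in> filler" using y y' assms by (auto simp: switchable_def filler_def)
  then show "z \<in> fst ` (switchable \<union> filler)" by force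
  have 1: "1 \<in> {1..5::nat}" by simp
  obtain x where x: "x \<in> {1..N}" "N dvd z - 24 * x"
    using ex_solution[OF N_pos, of 24 z] N_coprime by (auto simp: coprime_commute)
  obtain x' where x': "x' \<in> {1..N}" "N dvd z - 3 * x'"
    using ex_solution[OF N_pos, of 3 z] N_coprime by (auto simp: coprime_commute)
  have e1: "int (p 1) dvd z \<longleftrightarrow> int (p 1) dvd x"
    using divisibility_on_line(1)[OF 1, of 24 z x] dvd_trans[OF p_dvd[OF 1] x(2)] by simp
  have e2: "int (p t) dvd z \<longleftrightarrow> int (p t) dvd x'" if "t \<in> {1..5}" for t
    using divisibility_on_line(1)[OF that, of 3 z x'] dvd_trans[OF p_dvd[OF that] x'(2)] by simp
  have "(x, z) \<in> switchable \<or> (x', z) \<in> filler"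
    using x x' e1 e2[OF 1] e2 assms by (auto simp: switchable_def filler_def regular_def)
  then show "z \<in> snd ` (switchable \<union> filler)" by force
qed

text \<open>Off the torus, a queen of slope 3 is \<open>(x, 3 x - j N)\<close> with \<open>j\<close> among 0, 1, 2. Its sum \<open>4 x - j N\<close>
  misses one class modulo 4. Its difference is odd only for \<open>j = 1\<close>, that is for \<open>x\<close> in the middle
  third, where it is small. These are the real diagonals on which switchings take place.\<close>
lemma filler_sum: "c \<in> filler \<Longrightarrow> \<not> 4 dvd fst c + snd c - N"
  and filler_diff: "c \<in> filler \<Longrightarrow> odd (fst c - snd c) \<Longrightarrow> 3 * \<bar>fst c - snd c\<bar> \<le> N"
proof -
  assume c: "c \<in> filler"
  obtain x y where xy: "c = (x, y)" "x \<in> {1..N}" "y \<in> {1..N}" "N dvd y - 3 * x"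
    using c by (auto simp: filler_def)
  obtain i where i: "y - 3 * x = N * i" using xy by (auto elim: dvdE)
  have "i < 1"
  proof (rule ccontr)
    assume "\<not> i < 1"
    then have "N * 1 \<le> N * i" using N_pos by (intro mult_left_mono) auto
    then show False using i xy by auto
  qed
  moreover have "- 3 < i"
  proof (rule ccontr)
    assume "\<not> - 3 < i"
    then have "N * i \<le> N * (- 3)" using N_pos by (intro mult_left_mono) auto
    then show False using i xy by auto
  qed
  ultimately have i3: "i = 0 \<or> i = - 1 \<or> i = - 2" by auto
  show "\<not> 4 dvd fst c + snd c - N"
    using i3 i N_odd unfolding xy fst_conv snd_conv by (elim disjE) (simp_all, presburger+)
  assume "odd (fst c - snd c)"
  then have "i = - 1" using i3 i N_odd unfolding xy fst_conv snd_conv by (elim disjE) (simp_all, presburger+)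
  then have "3 * x = y + N" using i by simp
  then have "\<bar>3 * (x - y)\<bar> \<le> N" using xy by (simp add: abs_le_iff)
  then have "3 * \<bar>x - y\<bar> \<le> N" unfolding abs_mult by simp
  then show "3 * \<bar>fst c - snd c\<bar> \<le> N" using xy(1) by simp
qed

lemma coprime_p:
  assumes "s \<in> {1..5}" "t \<in> {1..5}" "s \<noteq> t" shows "coprime (p s) (p t)"
  using assms p_prime inj_onD[OF p_inj, of s t] by (intro primes_coprime) auto

text \<open>For every prime at most three residues are forbidden, and the primes exceed 3. So the
  Chinese remainder theorem yields a class modulo \<open>m\<close> of suitable squares in column \<open>u\<close>.\<close>
lemma ex_regular_cell:
  assumes F: "finite F" "card F < K" and K: "m * int K \<le> N"
  shows "\<exists>y\<in>{1..N}. y \<notin> F \<and> regular y \<and> regular (u + y) \<and> regular (u - y)"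
proof -
  have "\<exists>r. \<not> int (p t) dvd r \<and> \<not> int (p t) dvd u + r \<and> \<not> int (p t) dvd u - r" if t: "t \<in> {1..5}" for t
  proof (rule ccontr)
    let ?q = "int (p t)"
    assume "\<nexists>r. \<not> ?q dvd r \<and> \<not> ?q dvd u + r \<and> \<not> ?q dvd u - r"
    then have sub: "{1..4} \<subseteq> {r \<in> {1..4}. ?q dvd r} \<union> {r \<in> {1..4}. ?q dvd u + r} \<union> {r \<in> {1..4::int}. ?q dvd u - r}"
      by blast
    have empty: "{r \<in> {1..4}. ?q dvd r} = {}"
      using p_gt[OF t] zdvd_imp_le[of ?q] by fastforce
    have le1: "card {r \<in> {1..4::int}. ?q dvd f r} \<le> 1"
      if f: "\<And>r s. f r - f s = r - s \<or> f r - f s = s - r" for f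
    proof -
      have "r = s" if "r \<in> {1..4}" "s \<in> {1..4}" "?q dvd f r" "?q dvd f s" for r s
      proof (rule ccontr)
        assume "r \<noteq> s"
        have "?q dvd f r - f s" using that(3,4) by (rule dvd_diff)
        then have "?q dvd r - s" using f[of r s] by (metis dvd_diff_commute)
        then have "\<bar>?q\<bar> \<le> \<bar>r - s\<bar>" using \<open>r \<noteq> s\<close> by (intro dvd_imp_le_int) auto
        then show False using that p_gt[OF t] by auto
      qed
      moreover have "finite {r \<in> {1..4::int}. ?q dvd f r}" by (rule finite_subset[of _ "{1..4}"]) auto
      ultimately show ?thesis unfolding One_nat_def by (subst card_le_Suc0_iff_eq) blast+
    qed
    have fin: "finite {r \<in> {1..4::int}. Q r}" for Q by (rule finite_subset[of _ "{1..4}"]) auto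
    have "card {1..4::int} \<le> card ({r \<in> {1..4}. ?q dvd u + r} \<union> {r \<in> {1..4::int}. ?q dvd u - r})"
      by (rule card_mono[OF finite_UnI[OF fin fin]]) (use sub in \<open>unfold empty Un_empty_left\<close>)
    also have "\<dots> \<le> 1 + 1"
      using le1[of "\<lambda>r. u + r"] le1[of "\<lambda>r. u - r"]
      by (intro order_trans[OF card_Un_le] add_mono) auto
    finally show False by simp
  qed
  then obtain r where r: "\<And>t. t \<in> {1..5} \<Longrightarrow>
      \<not> int (p t) dvd r t \<and> \<not> int (p t) dvd u + r t \<and> \<not> int (p t) dvd u - r t" by metis
  obtain y0 where y0: "\<forall>t\<in>{1..5}. int (p t) dvd y0 - r t"
    using int_chinese_remainder[of "{1..5}" p r] coprime_p p_gt by fastforce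
  define Y where "Y = {y \<in> {1..<1 + m * int K}. m dvd y - y0}"
  have "card Y = K" unfolding Y_def by (rule card_residue_class[OF m_pos])
  moreover have "finite Y" unfolding Y_def by (rule finite_subset[of _ "{1..<1 + m * int K}"]) auto
  ultimately obtain y where y: "y \<in> Y" "y \<notin> F"
    using F by (metis card_mono linorder_not_le subsetI)
  have "\<not> int (p t) dvd y \<and> \<not> int (p t) dvd u + y \<and> \<not> int (p t) dvd u - y" if t: "t \<in> {1..5}" for t
  proof -
    have "int (p t) dvd y - y0" using y p_dvd_m[OF t] by (auto simp: Y_def intro: dvd_trans)
    then have "int (p t) dvd (y - y0) + (y0 - r t)" by (rule dvd_add) (use y0 t in blast)
    then have d: "int (p t) dvd y - r t" by simp
    have "int (p t) dvd y \<Longrightarrow> int (p t) dvd y - (y - r t)" by (rule dvd_diff[OF _ d])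
    moreover have "int (p t) dvd u + y \<Longrightarrow> int (p t) dvd (u + y) - (y - r t)" by (rule dvd_diff[OF _ d])
    moreover have "int (p t) dvd u - y \<Longrightarrow> int (p t) dvd (u - y) + (y - r t)" by (rule dvd_add[OF _ d])
    ultimately show ?thesis using r[OF t] by auto
  qed
  moreover have "y \<in> {1..N}" using y K by (auto simp: Y_def)
  ultimately show ?thesis using y by (auto simp: regular_def)
qed


lemma p_dvd_residue: "\<lbrakk>t \<in> {1..5}; m dvd x - y\<rbrakk> \<Longrightarrow> int (p t) dvd x - y"
  using dvd_trans[OF p_dvd_m] .

text \<open>A queen of slope 24 is \<open>(x, 24 x - j N)\<close> with \<open>0 \<le> j < 24\<close>. All divisibility conditions fix \<open>x\<close>
  modulo 4 and modulo the five primes; \<open>y\<close> is then determined modulo 4 by \<open>j\<close>. Taking \<open>j\<close> among the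
  first or last four values puts \<open>x\<close> into the outer sixth far from \<open>v\<close>, and restricting \<open>x\<close> to one end of
  the strip puts \<open>y\<close> into the outer sixth far from \<open>u\<close>.\<close>
lemma candidates:
  assumes u: "u \<in> {1..N}" and v: "v \<in> {1..N}" and K: "576 * (m * int K) < N"
  shows "\<exists>C\<subseteq>switchable. card C = K \<and> finite C \<and> (\<forall>(x, y)\<in>C.
     4 dvd u + y - N \<and> int (p 2) dvd u + y \<and> int (p 3) dvd u - y \<and> N < 3 * \<bar>u - y\<bar> \<and>
     4 dvd x + v - N \<and> int (p 4) dvd x + v \<and> int (p 5) dvd x - v \<and> N < 3 * \<bar>x - v\<bar>)"
proof -
  have T: "1 \<in> {1..5::nat}" "2 \<in> {1..5::nat}" "3 \<in> {1..5::nat}" "4 \<in> {1..5::nat}" "5 \<in> {1..5::nat}" by auto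
  have p0: "0 < int (p t)" if "t \<in> {1..5}" for t using p_gt[OF that] by simp
  have c24: "coprime 24 (int (p t))" if "t \<in> {1..5}" for t
    using prime_not_dvd[OF that, of 24] by (simp add: coprime_commute)
  obtain r2 where r2: "int (p 2) dvd - u - 24 * r2" using ex_solution[OF p0[OF T(2)] c24[OF T(2)]] by blast
  obtain r3 where r3: "int (p 3) dvd u - 24 * r3" using ex_solution[OF p0[OF T(3)] c24[OF T(3)]] by blast
  define \<mu> where "\<mu> = (\<lambda>t. if t = 0 then 4 else p t)"
  define r where "r = (\<lambda>t. [N - v, 0, r2, r3, - v, v] ! t)"
  have \<mu>0: "\<mu> t = p t" if "t \<in> {1..5}" for t using that by (simp add: \<mu>_def)
  have cop4: "coprime 4 (p t)" if "t \<in> {1..5}" for t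
    using prime_not_dvd[OF that, of 4] by (simp add: coprime_commute flip: coprime_int_iff)
  obtain \<xi> where \<xi>: "\<forall>t\<in>{0..5}. int (\<mu> t) dvd \<xi> - r t"
  proof -
    have "\<exists>x. \<forall>t\<in>{0..5}. int (\<mu> t) dvd x - r t"
    proof (rule int_chinese_remainder)
      show "0 < \<mu> t" if "t \<in> {0..5}" for t using p_gt[of t] that by (auto simp: \<mu>_def)
      show "coprime (\<mu> s) (\<mu> t)" if "s \<in> {0..5}" "t \<in> {0..5}" "s \<noteq> t" for s t
        using that cop4[of s] cop4[of t] coprime_p[of s t] by (auto simp: \<mu>_def coprime_commute)
    qed simp
    then show ?thesis using that by blast
  qed
  have \<xi>': "4 dvd \<xi> - (N - v)" "int (p 1) dvd \<xi>" "int (p 2) dvd \<xi> - r2" "int (p 3) dvd \<xi> - r3"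
    "int (p 4) dvd \<xi> + v" "int (p 5) dvd \<xi> - v"
    using \<xi>[rule_format, of 0] \<xi>[rule_format, of 1] \<xi>[rule_format, of 2] \<xi>[rule_format, of 3]
      \<xi>[rule_format, of 4] \<xi>[rule_format, of 5]
    by (simp_all add: \<mu>_def r_def eval_nat_numeral)
  \<comment> \<open>the first or the last four of the 24 strips, and the bottom or the top part of the strip\<close>
  define j where "j = (if N < 2 * v then 0 else 20) + (N * (u - N)) mod 4"
  define a where "a = (if N < 2 * u then (j * N) div 24 + 1 else ((j + 1) * N) div 24 + 1 - 4 * m * int K)"
  define X where "X = {x \<in> {a..<a + (4 * m) * int K}. 4 * m dvd x - \<xi>}"
  define C where "C = (\<lambda>x. (x, 24 * x - j * N)) ` X"
  have j4: "4 dvd j * N - (u - N)"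
  proof -
    have "4 dvd N * N - 1" using N_odd by (auto elim!: oddE simp: algebra_simps)
    then have "4 dvd (N * N - 1) * (u - N)" by (rule dvd_mult2)
    moreover have "4 dvd (N * (u - N)) mod 4 - N * (u - N)"
      using mod_eq_dvd_iff[of "(N * (u - N)) mod 4" 4 "N * (u - N)"] by simp
    then have "4 dvd (if N < 2 * v then 0 else 20) + ((N * (u - N)) mod 4 - N * (u - N))"
      by (intro dvd_add) auto
    then have "4 dvd j - N * (u - N)" unfolding j_def by (simp only: add_diff_eq)
    then have "4 dvd N * (j - N * (u - N))" by (rule dvd_mult)
    moreover have "j * N - (u - N) = N * (j - N * (u - N)) + (N * N - 1) * (u - N)"
      by (simp add: algebra_simps)
    ultimately show ?thesis by (metis dvd_add)
  qed
  have jr: "if N < 2 * v then 0 \<le> j \<and> j \<le> 3 else 20 \<le> j \<and> j \<le> 23"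
    using pos_mod_bound[of 4 "N * (u - N)"] pos_mod_sign[of 4 "N * (u - N)"] unfolding j_def by auto
  have fX: "finite X" unfolding X_def by (rule finite_subset[of _ "{a..<a + (4 * m) * int K}"]) auto
  have "card X = K" unfolding X_def by (rule card_residue_class) (use m_pos in simp)
  then have cardC: "card C = K" unfolding C_def by (subst card_image) (auto simp: inj_on_def)
  have mK: "0 \<le> m * int K" using m_pos by simp
  have good_x: "(x, 24 * x - j * N) \<in> switchable \<and>
     4 dvd u + (24 * x - j * N) - N \<and> int (p 2) dvd u + (24 * x - j * N) \<and> int (p 3) dvd u - (24 * x - j * N)
     \<and> N < 3 * \<bar>u - (24 * x - j * N)\<bar> \<and>
     4 dvd x + v - N \<and> int (p 4) dvd x + v \<and> int (p 5) dvd x - v \<and> N < 3 * \<bar>x - v\<bar>" if x: "x \<in> X" for x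
  proof -
    define y where "y = 24 * x - j * N"
    have xa: "a \<le> x" "x < a + 4 * (m * int K)" and d: "4 * m dvd x - \<xi>" using x by (auto simp: X_def mult.assoc)
    have d4: "4 dvd x - \<xi>" using d by (rule dvd_mult_left)
    have dm: "m dvd x - \<xi>" using d by (rule dvd_mult_right)
    have dp: "int (p t) dvd x - \<xi>" if "t \<in> {1..5}" for t using dvd_trans[OF p_dvd_m[OF that] dm] .
    have y: "0 < y" "y \<le> N" and yc: "if N < 2 * u then 6 * y < N else 5 * N < 6 * y"
    proof -
      have "(if N < 2 * u then 0 < y \<and> 6 * y < N else y \<le> N \<and> 5 * N < 6 * y)"
      proof (cases "N < 2 * u")
        case True
        define b where "b = (j * N) div 24"
        have b: "24 * b \<le> j * N" "j * N < 24 * b + 24"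
          using div_mult_mod_eq[of "j * N" 24] pos_mod_bound[of 24 "j * N"] pos_mod_sign[of 24 "j * N"]
          unfolding b_def by linarith+
        have "b + 1 \<le> x" "x \<le> b + 4 * (m * int K)" using xa True by (simp_all add: a_def b_def)
        then show ?thesis using True b K unfolding y_def by auto
      next
        case False
        define b where "b = ((j + 1) * N) div 24"
        have b: "24 * b \<le> (j + 1) * N" "(j + 1) * N < 24 * b + 24"
          using div_mult_mod_eq[of "(j + 1) * N" 24] pos_mod_bound[of 24 "(j + 1) * N"] pos_mod_sign[of 24 "(j + 1) * N"]
          unfolding b_def by linarith+
        have jN: "(j + 1) * N = j * N + N" by (simp add: algebra_simps)
        have "b + 1 - 4 * (m * int K) \<le> x" "x \<le> b" using xa False by (simp_all add: a_def b_def)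
        then show ?thesis using False b K jN unfolding y_def by auto
      qed
      then show "0 < y" "y \<le> N" "if N < 2 * u then 6 * y < N else 5 * N < 6 * y"
        using N_pos by (auto split: if_splits)
    qed
    have xr: "if N < 2 * v then 1 \<le> x \<and> 6 * x < N else x \<le> N \<and> 5 * N < 6 * x"
    proof (cases "N < 2 * v")
      case True
      then have "0 * N \<le> j * N" "j * N \<le> 3 * N" using jr N_pos by (auto intro: mult_right_mono)
      then have "0 < x" "24 * x \<le> 4 * N" using y unfolding y_def by linarith+
      moreover have "6 * x \<noteq> N" using N_odd by auto
      ultimately show ?thesis using True by auto
    next
      case False
      then have "20 * N \<le> j * N" "j * N \<le> 23 * N" using jr N_pos by (auto intro: mult_right_mono)
      then have "20 * N < 24 * x" "24 * x \<le> 24 * N" using y unfolding y_def by linarith+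
      then show ?thesis using False by auto
    qed
    have x1: "x \<in> {1..N}" using xr N_pos by (auto split: if_splits)
    have "int (p 1) dvd (x - \<xi>) + \<xi>" using dp[OF T(1)] \<xi>'(2) by (rule dvd_add)
    then have "int (p 1) dvd x" by simp
    moreover have "N dvd y - 24 * x" by (simp add: y_def)
    ultimately have "(x, y) \<in> switchable" using x1 y by (simp add: switchable_def)
    moreover have "4 dvd u + y - N"
    proof -
      have "u + y - N = 24 * x - (j * N - (u - N))" by (simp add: y_def)
      also have "4 dvd \<dots>" by (rule dvd_diff[OF dvd_mult2 j4]) simp
      finally show ?thesis .
    qed
    moreover have "int (p 2) dvd u + y"
    proof -
      have pN: "int (p 2) dvd N * j" using p_dvd[OF T(2)] by (rule dvd_mult2)
      have 1: "int (p 2) dvd 24 * ((x - \<xi>) + (\<xi> - r2))" using dvd_add[OF dp[OF T(2)] \<xi>'(3)] by (rule dvd_mult)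
      have "u + y = (24 * ((x - \<xi>) + (\<xi> - r2)) - N * j) - (- u - 24 * r2)" by (simp add: y_def algebra_simps)
      also have "int (p 2) dvd \<dots>" by (rule dvd_diff[OF dvd_diff[OF 1 pN] r2])
      finally show ?thesis .
    qed
    moreover have "int (p 3) dvd u - y"
    proof -
      have pN: "int (p 3) dvd N * j" using p_dvd[OF T(3)] by (rule dvd_mult2)
      have 1: "int (p 3) dvd 24 * ((x - \<xi>) + (\<xi> - r3))" using dvd_add[OF dp[OF T(3)] \<xi>'(4)] by (rule dvd_mult)
      have "u - y = (u - 24 * r3) - (24 * ((x - \<xi>) + (\<xi> - r3)) - N * j)" by (simp add: y_def algebra_simps)
      also have "int (p 3) dvd \<dots>" by (rule dvd_diff[OF r3 dvd_diff[OF 1 pN]])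
      finally show ?thesis .
    qed
    moreover have "N < 3 * \<bar>u - y\<bar>"
      using yc abs_ge_self[of "u - y"] abs_ge_minus_self[of "u - y"] by (auto split: if_splits)
    moreover have "4 dvd x + v - N" using dvd_add[OF d4 \<xi>'(1)] by (simp add: algebra_simps)
    moreover have "int (p 4) dvd x + v" using dvd_add[OF dp[OF T(4)] \<xi>'(5)] by (simp add: algebra_simps)
    moreover have "int (p 5) dvd x - v" using dvd_add[OF dp[OF T(5)] \<xi>'(6)] by (simp add: algebra_simps)
    moreover have "N < 3 * \<bar>x - v\<bar>"
      using xr abs_ge_self[of "x - v"] abs_ge_minus_self[of "x - v"] by (auto split: if_splits)
    ultimately show ?thesis unfolding y_def by blast
  qed
  show ?thesis
    by (intro exI[of _ C] conjI) (use good_x cardC fX in \<open>auto simp: C_def\<close>)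
qed

text \<open>A prime other than \<open>p 1\<close> dividing the line excludes the random queens, non-divisibility by \<open>p 1\<close>
  excludes those of slope 24, and the remaining conditions exclude those of slope 3 by \<open>filler_sum\<close> and
  \<open>filler_diff\<close>.\<close>
lemma free_diagonals:
  assumes b: "b \<in> cells \<union> switchable \<union> filler" and p1: "\<not> int (p 1) dvd s" "\<not> int (p 1) dvd d"
    and s: "4 dvd s - N" "t \<in> {1..5}" "int (p t) dvd s"
    and d: "N < 3 * \<bar>d\<bar>" "t' \<in> {1..5}" "int (p t') dvd d" and par: "even (s - d)"
  shows "s \<noteq> fst b + snd b" "d \<noteq> fst b - snd b"
proof -
  have 1: "1 \<in> {1..5::nat}" by simp
  consider "b \<in> cells" | "b \<in> switchable" | "b \<in> filler" using b by blast
  then have "s \<noteq> fst b + snd b \<and> d \<noteq> fst b - snd b"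
  proof cases
    case 1
    then have "regular (fst b)" by (rule cells_fst)
    then show ?thesis using divisibility(2)[OF s(2) b] divisibility(3)[OF d(2) b] s d
      unfolding regular_def by auto
  next
    case 2
    then have "int (p 1) dvd fst b" by (rule switchable_fst)
    then show ?thesis using divisibility(2)[OF 1 b] divisibility(3)[OF 1 b] p1 by auto
  next
    case 3
    have "odd s"
    proof
      assume "even s"
      moreover have "2 dvd s - N" using s(1) by (rule dvd_trans[rotated]) simp
      ultimately have "even N" by simp
      then show False using N_odd by simp
    qed
    then have "odd d" using par by simp
    then show ?thesis using filler_sum[OF 3] filler_diff[OF 3] s d by auto
  qed
  then show "s \<noteq> fst b + snd b" "d \<noteq> fst b - snd b" by auto
qed

lemma card_hits:
  assumes "inj_on f C" "finite Y"
  shows "card {c \<in> C. f c \<in> Y} \<le> card Y"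
  by (rule card_inj_on_le[of f]) (use assms in \<open>auto intro: inj_on_subset\<close>)

text \<open>Every step covers one more column and row. The set \<open>X\<close> collects the queens that are under no
  arithmetic control, namely the border queens and those added by switchings, and \<open>Z\<close> the queens of
  slope 24 already traded. A queen of \<open>X\<close> spoils at most four candidates, a queen of \<open>Z\<close> one, and two
  are lost because the two new queens must not attack each other; since a step adds two queens to
  \<open>X\<close> and one to \<open>Z\<close>, each open column costs nine.\<close>
lemma absorb:
  assumes n: "N \<le> int n" and K: "576 * (m * int K) < N"
    and R: "non_attacking R" "R \<subseteq> board n" "P' \<subseteq> R" "P' \<subseteq> cells"
      "R \<subseteq> cells \<union> switchable \<union> filler \<union> X" "switchable - Z \<subseteq> R" "finite X" "finite Z"
    and fstR: "\<And>u. u \<in> {1..int n} - fst ` R \<Longrightarrow> u \<le> N \<and> regular u"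
    and sndR: "\<And>u. u \<in> {1..int n} - snd ` R \<Longrightarrow> u \<le> N \<and> regular u"
    and budget: "4 * card X + card Z + 9 * (n - card R) + 2 < K"
  shows "\<exists>Q. queens_configuration n Q \<and> P' \<subseteq> Q"
  using R fstR sndR budget
proof (induction "n - card R" arbitrary: R X Z)
  case 0
  have fin: "finite R" by (rule finite_subset[OF 0(3)]) (simp add: board_def)
  have "card R = card (fst ` R)" using non_attacking_inj(1)[OF 0(2)] by (simp add: card_image)
  also have "\<dots> \<le> card {1..int n}" using 0(3) by (intro card_mono) (auto simp: board_def)
  finally have "card R = n" using 0(1) by simp
  then show ?case using 0 queens_configuration_iff by blast
next
  case (Suc k R X Z)
  note na = Suc.prems(1) and bd = Suc.prems(2) and P'R = Suc.prems(3) and P'c = Suc.prems(4)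
    and Rsub = Suc.prems(5) and core_R = Suc.prems(6) and finX = Suc.prems(7) and finZ = Suc.prems(8)
    and fstR = Suc.prems(9) and sndR = Suc.prems(10) and budget = Suc.prems(11)
  have fin: "finite R" by (rule finite_subset[OF bd]) (simp add: board_def)
  have cR: "card (fst ` R) = card R" "card (snd ` R) = card R"
    using non_attacking_inj(1,2)[OF na] by (simp_all add: card_image)
  have lt: "card R < n" using Suc.hyps(2) by simp
  have "\<not> {1..int n} \<subseteq> fst ` R" "\<not> {1..int n} \<subseteq> snd ` R"
    using card_mono[of "fst ` R" "{1..int n}"] card_mono[of "snd ` R" "{1..int n}"] fin cR lt by auto
  then obtain u v where uv: "u \<in> {1..int n}" "u \<notin> fst ` R" "v \<in> {1..int n}" "v \<notin> snd ` R" by blast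
  have ru: "u \<in> {1..N}" "regular u" and rv: "v \<in> {1..N}" "regular v"
    using fstR[of u] sndR[of v] uv by auto
  obtain C where C: "C \<subseteq> switchable" "card C = K" "finite C" and Cp: "\<And>x y. (x, y) \<in> C \<Longrightarrow>
     4 dvd u + y - N \<and> int (p 2) dvd u + y \<and> int (p 3) dvd u - y \<and> N < 3 * \<bar>u - y\<bar> \<and>
     4 dvd x + v - N \<and> int (p 4) dvd x + v \<and> int (p 5) dvd x - v \<and> N < 3 * \<bar>x - v\<bar>"
    using candidates[OF ru(1) rv(1) K] by blast
  have naC: "non_attacking C" using non_attacking_subset[OF non_attacking_switchable C(1)] .
  note inj = non_attacking_inj[OF naC]
  define S where "S = (\<lambda>c. fst c + snd c) ` X"
  define D where "D = (\<lambda>c. fst c - snd c) ` X"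
  have SD: "finite S" "finite D" "card S \<le> card X" "card D \<le> card X"
    using finX by (auto simp: S_def D_def intro: card_image_le)
  define bad where "bad = {c \<in> C. u + snd c \<in> S} \<union> {c \<in> C. u - snd c \<in> D} \<union> {c \<in> C. fst c + v \<in> S}
     \<union> {c \<in> C. fst c - v \<in> D} \<union> {c \<in> C. fst c - snd c \<in> {u - v}} \<union> {c \<in> C. fst c + snd c \<in> {u + v}} \<union> Z"
  have i1: "inj_on (\<lambda>c. u + snd c) C" "inj_on (\<lambda>c. u - snd c) C" "inj_on (\<lambda>c. fst c + v) C" "inj_on (\<lambda>c. fst c - v) C"
    using inj(1,2) by (auto simp: inj_on_def)
  have "card bad \<le> card S + card D + card S + card D + 1 + 1 + card Z"
    unfolding bad_def
    using card_hits[OF i1(1) SD(1)] card_hits[OF i1(2) SD(2)] card_hits[OF i1(3) SD(1)] card_hits[OF i1(4) SD(2)]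
      card_hits[OF inj(4), of "{u - v}"] card_hits[OF inj(3), of "{u + v}"]
    by (intro order_trans[OF card_Un_le] add_mono) simp_all
  then have "card bad < card C" using SD budget C(2) by linarith
  moreover have "finite bad" using C(3) finZ by (simp add: bad_def)
  ultimately obtain c where c: "c \<in> C" "c \<notin> bad" by (metis card_mono linorder_not_le subsetI)
  obtain x y where xy: "c = (x, y)" by (cases c)
  have xy_mem: "(x, y) \<in> switchable" using c C xy by blast
  have nb: "u + y \<notin> S" "u - y \<notin> D" "x + v \<notin> S" "x - v \<notin> D" "x - y \<noteq> u - v" "x + y \<noteq> u + v" "(x, y) \<notin> Z"
    using c xy by (auto simp: bad_def)
  note cp = Cp[OF c(1)[unfolded xy]]
  have cR': "(x, y) \<in> R" using xy_mem nb(7) core_R by blast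
  have T: "1 \<in> {1..5::nat}" "2 \<in> {1..5::nat}" "3 \<in> {1..5::nat}" "4 \<in> {1..5::nat}" "5 \<in> {1..5::nat}" by auto
  have p1: "int (p 1) dvd x" "int (p 1) dvd y"
    using xy_mem switchable_fst[OF xy_mem] divisibility(1)[OF T(1), of "(x, y)"] by auto
  have p1': "\<not> int (p 1) dvd u + y" "\<not> int (p 1) dvd u - y" "\<not> int (p 1) dvd x + v" "\<not> int (p 1) dvd x - v"
    using p1 ru(2) rv(2) T(1) unfolding regular_def by (auto simp: dvd_add_left_iff dvd_add_right_iff dvd_diff_left_iff dvd_diff_right_iff)
  have fu: "u + y \<noteq> fst b + snd b \<and> u - y \<noteq> fst b - snd b" if b: "b \<in> R" for b
  proof (cases "b \<in> X")
    case True
    then show ?thesis using nb(1,2) by (auto simp: S_def D_def image_iff)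
  next
    case False
    then have "b \<in> cells \<union> switchable \<union> filler" using b Rsub by blast
    then show ?thesis using free_diagonals[of b "u + y" "u - y" 2 3] cp p1' T by auto
  qed
  have fv: "x + v \<noteq> fst b + snd b \<and> x - v \<noteq> fst b - snd b" if b: "b \<in> R" for b
  proof (cases "b \<in> X")
    case True
    then show ?thesis using nb(3,4) by (auto simp: S_def D_def image_iff)
  next
    case False
    then have "b \<in> cells \<union> switchable \<union> filler" using b Rsub by blast
    then show ?thesis using free_diagonals[of b "x + v" "x - v" 4 5] cp p1' T by auto
  qed
  define R0 where "R0 = R - {(x, y)}"
  define R' where "R' = insert (u, y) (insert (x, v) R0)"
  have y_only: "b = (x, y)" if "b \<in> R" "snd b = y" for b
    using non_attackingD[OF na that(1) cR'] that by (simp add: attack_def)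
  have x_only: "b = (x, y)" if "b \<in> R" "fst b = x" for b
    using non_attackingD[OF na that(1) cR'] that by (simp add: attack_def)
  have na0: "non_attacking R0" using non_attacking_subset[OF na] by (auto simp: R0_def)
  have na1: "non_attacking (insert (x, v) R0)"
  proof (rule non_attacking_insert[OF na0])
    fix b assume b: "b \<in> R0"
    then show "\<not> attack (x, v) b" using fv[of b] x_only[of b] uv(4) by (auto simp: attack_def R0_def image_iff)
  qed
  have ux: "u \<noteq> x" "v \<noteq> y" using uv cR' by (auto simp: image_iff)
  have na': "non_attacking R'" unfolding R'_def
  proof (rule non_attacking_insert[OF na1])
    fix b assume "b \<in> insert (x, v) R0"
    then consider "b = (x, v)" | "b \<in> R0" by blast
    then show "\<not> attack (u, y) b"
    proof cases
      case 1
      then show ?thesis using ux nb(5,6) by (auto simp: attack_def)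
    next
      case 2
      then show ?thesis using fu[of b] y_only[of b] uv(2) by (auto simp: attack_def R0_def image_iff)
    qed
  qed
  have new: "(u, y) \<notin> insert (x, v) R0" "(x, v) \<notin> R0" using uv ux by (auto simp: R0_def image_iff)
  have fin0: "finite R0" "card R0 = card R - 1" using fin cR' by (simp_all add: R0_def)
  have "card R > 0" using cR' fin by (auto simp: card_gt_0_iff)
  then have card': "card R' = card R + 1" using new fin0 by (simp add: R'_def)
  have bd': "R' \<subseteq> board n"
    using bd cR' uv by (auto simp: R'_def R0_def board_def)
  have P'': "P' \<subseteq> R'"
  proof -
    have "(x, y) \<notin> P'" using P'c cells_fst switchable_fst[OF xy_mem] T(1) by (auto simp: regular_def)
    then show ?thesis using P'R by (auto simp: R'_def R0_def)
  qed
  have f1: "fst ` R \<subseteq> fst ` R'" "snd ` R \<subseteq> snd ` R'"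
  proof -
    show "fst ` R \<subseteq> fst ` R'"
    proof
      fix z assume "z \<in> fst ` R"
      then obtain b where "b \<in> R" "z = fst b" by blast
      then show "z \<in> fst ` R'" by (cases "b = (x, y)") (auto simp: R'_def R0_def)
    qed
    show "snd ` R \<subseteq> snd ` R'"
    proof
      fix z assume "z \<in> snd ` R"
      then obtain b where "b \<in> R" "z = snd b" by blast
      then show "z \<in> snd ` R'" by (cases "b = (x, y)") (auto simp: R'_def R0_def)
    qed
  qed
  have cX: "card (X \<union> {(u, y), (x, v)}) \<le> card X + 2"
    using card_Un_le[of X "{(u, y), (x, v)}"] card_insert_le_m1[of 2 "{(x, v)}" "(u, y)"] by simp
  have cZ: "card (insert (x, y) Z) \<le> card Z + 1" by (simp add: card_insert_if finZ)
  show ?case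
  proof (rule Suc.hyps(1)[of R' "X \<union> {(u, y), (x, v)}" "insert (x, y) Z"])
    show "k = n - card R'" using Suc.hyps(2) card' by simp
    show "R' \<subseteq> cells \<union> switchable \<union> filler \<union> (X \<union> {(u, y), (x, v)})" using Rsub by (auto simp: R'_def R0_def)
    show "switchable - insert (x, y) Z \<subseteq> R'" using core_R by (auto simp: R'_def R0_def)
    show "z \<le> N \<and> regular z" if "z \<in> {1..int n} - fst ` R'" for z using that f1 fstR by blast
    show "z \<le> N \<and> regular z" if "z \<in> {1..int n} - snd ` R'" for z using that f1 sndR by blast
    show "4 * card (X \<union> {(u, y), (x, v)}) + card (insert (x, y) Z) + 9 * (n - card R') + 2 < K"
      using cX cZ budget lt card' by linarith
  qed (use na' bd' P'' P'c finX finZ in auto)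
qed


text \<open>The \<open>w\<close> columns and rows beyond \<open>N\<close> receive queens whose other lines are regular, so that they can
  only attack random queens. This keeps every irregular line up to \<open>N\<close> occupied, as the
  switchings require.\<close>
lemma ex_border_queens:
  assumes K: "m * int K \<le> N" and w: "6 * w < K"
  shows "\<exists>X. finite X \<and> card X \<le> 2 * w \<and> non_attacking X \<and> X \<subseteq> {1..N + int w} \<times> {1..N + int w}
    \<and> {N + 1..N + int w} \<subseteq> fst ` X \<and> {N + 1..N + int w} \<subseteq> snd ` X
    \<and> (\<forall>c\<in>X. (N < fst c \<or> regular (fst c)) \<and> (N < snd c \<or> regular (snd c))
         \<and> regular (fst c + snd c) \<and> regular (fst c - snd c))"
  using w
proof (induction w)
  case 0
  show ?case by (rule exI[of _ "{}"]) (simp add: non_attacking_def)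
next
  case (Suc w)
  then obtain X where fin: "finite X" and cX: "card X \<le> 2 * w" and na: "non_attacking X"
    and sub: "X \<subseteq> {1..N + int w} \<times> {1..N + int w}"
    and cov: "{N + 1..N + int w} \<subseteq> fst ` X" "{N + 1..N + int w} \<subseteq> snd ` X"
    and reg: "\<forall>c\<in>X. (N < fst c \<or> regular (fst c)) \<and> (N < snd c \<or> regular (snd c))
         \<and> regular (fst c + snd c) \<and> regular (fst c - snd c)" by auto
  define u where "u = N + int w + 1"
  have card3: "card (f ` Y \<union> g ` Y \<union> h ` Y) < K" if "finite Y" "card Y \<le> 2 * w + 1" for f g h :: "int \<times> int \<Rightarrow> int" and Y
  proof -
    have "card (f ` Y \<union> g ` Y \<union> h ` Y) \<le> card Y + card Y + card Y"
      using that(1) by (intro order_trans[OF card_Un_le] add_mono card_image_le)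
    moreover have "6 * w + 6 < K" using Suc.prems by simp
    ultimately show ?thesis using that(2) by linarith
  qed
  let ?F = "snd ` X \<union> (\<lambda>b. fst b + snd b - u) ` X \<union> (\<lambda>b. u - (fst b - snd b)) ` X"
  have F: "finite ?F" "card ?F < K"
    using fin card3[OF fin, of snd "\<lambda>b. fst b + snd b - u" "\<lambda>b. u - (fst b - snd b)"] cX by simp_all
  obtain y where y: "y \<in> {1..N}" "y \<notin> ?F" "regular y" "regular (u + y)" "regular (u - y)"
    using ex_regular_cell[OF F K, of u] by blast
  define X1 where "X1 = insert (u, y) X"
  have na1: "non_attacking X1" unfolding X1_def
  proof (rule non_attacking_insert[OF na])
    fix b assume b: "b \<in> X"
    then have "fst b \<noteq> u" using sub by (auto simp: u_def)
    moreover have "y \<noteq> snd b" "y \<noteq> fst b + snd b - u" "y \<noteq> u - (fst b - snd b)" using y(2) b by blast+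
    ultimately show "\<not> attack (u, y) b" by (auto simp: attack_def)
  qed
  have fin1: "finite X1" "card X1 \<le> 2 * w + 1" using fin cX by (auto simp: X1_def card_insert_if)
  let ?G = "fst ` X1 \<union> (\<lambda>b. fst b + snd b - u) ` X1 \<union> (\<lambda>b. u + (fst b - snd b)) ` X1"
  have G: "finite ?G" "card ?G < K"
    using fin1 card3[OF fin1, of fst "\<lambda>b. fst b + snd b - u" "\<lambda>b. u + (fst b - snd b)"] by simp_all
  obtain x where x: "x \<in> {1..N}" "x \<notin> ?G" "regular x" "regular (u + x)" "regular (u - x)"
    using ex_regular_cell[OF G K, of u] by blast
  have x': "regular (x + u)" "regular (x - u)"
    using x(4,5) unfolding regular_def by (simp_all add: add.commute dvd_diff_commute[of _ u x])
  define X2 where "X2 = insert (x, u) X1"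
  have na2: "non_attacking X2" unfolding X2_def
  proof (rule non_attacking_insert[OF na1])
    fix b assume b: "b \<in> X1"
    then have "snd b \<noteq> u" using sub y by (auto simp: u_def X1_def)
    moreover have "x \<noteq> fst b" "x \<noteq> fst b + snd b - u" "x \<noteq> u + (fst b - snd b)" using x(2) b by blast+
    ultimately show "\<not> attack (x, u) b" by (auto simp: attack_def)
  qed
  have iv: "{N + 1..N + int (Suc w)} = insert u {N + 1..N + int w}" by (auto simp: u_def)
  show ?case
  proof (intro exI[of _ X2] conjI)
    show "card X2 \<le> 2 * Suc w" using fin1 by (auto simp: X2_def card_insert_if)
    show "X2 \<subseteq> {1..N + int (Suc w)} \<times> {1..N + int (Suc w)}"
      using sub x y N_pos by (auto simp: X2_def X1_def u_def)
    show "{N + 1..N + int (Suc w)} \<subseteq> fst ` X2" "{N + 1..N + int (Suc w)} \<subseteq> snd ` X2"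
      unfolding iv using cov by (auto simp: X2_def X1_def)
    show "\<forall>c\<in>X2. (N < fst c \<or> regular (fst c)) \<and> (N < snd c \<or> regular (snd c))
         \<and> regular (fst c + snd c) \<and> regular (fst c - snd c)"
      using reg x x' y by (auto simp: X2_def X1_def u_def)
  qed (use fin1 na2 in \<open>auto simp: X2_def\<close>)
qed

lemma irregular_lines:
  assumes "b \<in> switchable \<union> filler"
  shows "\<not> regular (fst b) \<and> \<not> regular (snd b) \<and> \<not> regular (fst b + snd b) \<and> \<not> regular (fst b - snd b)"
proof -
  have "\<not> regular (fst b)" using assms switchable_fst[of b] filler_fst[of b] by (auto simp: regular_def)
  then obtain t where t: "t \<in> {1..5}" "int (p t) dvd fst b" by (auto simp: regular_def)
  then show ?thesis using divisibility[OF t(1), of b] assms unfolding regular_def by blast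
qed

lemma card_attacked:
  assumes P: "non_attacking P" and X: "finite X"
  shows "card {b \<in> P. \<exists>c\<in>X. attack c b} \<le> 4 * card X"
proof -
  note inj = non_attacking_inj[OF P]
  have "card {b \<in> P. attack c b} \<le> 4" for c
  proof -
    have eq: "{b \<in> P. attack c b} = {b \<in> P. fst b \<in> {fst c}} \<union> {b \<in> P. snd b \<in> {snd c}} \<union>
      {b \<in> P. fst b + snd b \<in> {fst c + snd c}} \<union> {b \<in> P. fst b - snd b \<in> {fst c - snd c}}"
      by (auto simp: attack_def)
    have "card {b \<in> P. attack c b} \<le> 1 + 1 + 1 + 1"
      unfolding eq
      using card_hits[OF inj(1), of "{fst c}"] card_hits[OF inj(2), of "{snd c}"]
        card_hits[OF inj(3), of "{fst c + snd c}"] card_hits[OF inj(4), of "{fst c - snd c}"]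
      by (intro order_trans[OF card_Un_le] add_mono) simp_all
    then show ?thesis by simp
  qed
  then have "(\<Sum>c\<in>X. card {b \<in> P. attack c b}) \<le> (\<Sum>c\<in>X. 4)" by (intro sum_mono)
  moreover have "{b \<in> P. \<exists>c\<in>X. attack c b} = (\<Union>c\<in>X. {b \<in> P. attack c b})" by auto
  ultimately show ?thesis using card_UN_le[OF X, of "\<lambda>c. {b \<in> P. attack c b}"] by simp
qed

text \<open>Random queens are removed only where a border queen attacks them, which is why a bounded number of
  queens of \<open>P\<close> is lost; the switchings remove queens of slope 24 only.\<close>
theorem completion:
  assumes n: "N \<le> int n" "int n \<le> N + int w"
    and P: "P \<subseteq> cells" "non_attacking P" "card {x \<in> {1..N}. regular x} \<le> card P + d"
    and K: "576 * (m * int K) < N" "9 * (d + 8 * w) + 8 * w + 2 < K"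
  shows "\<exists>Q. queens_configuration n Q \<and> card (P - Q) \<le> 8 * w"
proof -
  define w' where "w' = nat (int n - N)"
  have w': "int n = N + int w'" "w' \<le> w" using n by (auto simp: w'_def)
  have mK: "0 \<le> m * int K" using m_pos by simp
  obtain X where fin: "finite X" and cX: "card X \<le> 2 * w'" and naX: "non_attacking X"
    and sub: "X \<subseteq> {1..int n} \<times> {1..int n}"
    and cov: "{N + 1..int n} \<subseteq> fst ` X" "{N + 1..int n} \<subseteq> snd ` X"
    and reg: "\<forall>c\<in>X. (N < fst c \<or> regular (fst c)) \<and> (N < snd c \<or> regular (snd c))
         \<and> regular (fst c + snd c) \<and> regular (fst c - snd c)"
    using ex_border_queens[of K w'] K mK w' by auto
  define P' where "P' = {b \<in> P. \<not> (\<exists>c\<in>X. attack c b)}"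
  have finP: "finite P" using P(1) by (rule finite_subset)
    (rule finite_subset[of _ "{1..N} \<times> {1..N}"], auto simp: cells_def)
  have PP': "P - P' = {b \<in> P. \<exists>c\<in>X. attack c b}" "P' \<subseteq> P" by (auto simp: P'_def)
  have removed: "card (P - P') \<le> 8 * w'"
    unfolding PP' using card_attacked[OF P(2) fin] cX by linarith
  have cP: "card P = card P' + card (P - P')"
    using card_Diff_subset[of P' P] card_mono[OF finP PP'(2)] finite_subset[OF PP'(2) finP] PP'(2) by simp
  define R where "R = P' \<union> switchable \<union> filler \<union> X"
  have naR: "non_attacking R" unfolding R_def
  proof (rule non_attacking_Un[OF _ naX])
    show "non_attacking (P' \<union> switchable \<union> filler)"
      by (rule non_attacking_core) (use P PP' non_attacking_subset in auto)
    fix b c assume b: "b \<in> P' \<union> switchable \<union> filler" and c: "c \<in> X"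
    show "\<not> attack b c"
    proof (cases "b \<in> P'")
      case True
      then show ?thesis using c attack_sym[of b c] by (auto simp: P'_def)
    next
      case False
      then have b': "b \<in> switchable \<union> filler" using b by blast
      then have "fst b \<le> N" "snd b \<le> N" by (auto simp: switchable_def filler_def)
      then show ?thesis using irregular_lines[OF b'] reg[rule_format, OF c] by (auto simp: attack_def)
    qed
  qed
  have bd: "R \<subseteq> board n"
    unfolding R_def board_def using sub n(1) P(1) PP'(2) by (auto simp: switchable_def filler_def cells_def)
  have finR: "finite R" by (rule finite_subset[OF bd]) (simp add: board_def)
  have unc: "z \<le> N \<and> regular z" if z: "z \<in> {1..int n}" "z \<notin> fst ` R \<or> z \<notin> snd ` R" for z
  proof -
    have "z \<le> N"
    proof (rule ccontr)
      assume "\<not> z \<le> N"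
      then have "z \<in> {N + 1..int n}" using z(1) by auto
      then show False using z(2) cov by (auto simp: R_def)
    qed
    moreover have "regular z"
    proof (rule ccontr)
      assume "\<not> regular z"
      then show False using covers_irregular[of z] z \<open>z \<le> N\<close> by (auto simp: R_def)
    qed
    ultimately show ?thesis by simp
  qed
  have deficit: "n - card R \<le> d + 8 * w"
  proof -
    have "card (fst ` R) = card R" using non_attacking_inj(1)[OF naR] by (simp add: card_image)
    moreover have "fst ` R \<subseteq> {1..int n}" using bd by (auto simp: board_def)
    ultimately have "n - card R = card ({1..int n} - fst ` R)"
      using card_Diff_subset[of "fst ` R" "{1..int n}"] finR by simp
    also have "\<dots> \<le> card ({x \<in> {1..N}. regular x} - fst ` P')"
    proof (rule card_mono)
      show "finite ({x \<in> {1..N}. regular x} - fst ` P')"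
        by (rule finite_subset[of _ "{1..N}"]) auto
      show "{1..int n} - fst ` R \<subseteq> {x \<in> {1..N}. regular x} - fst ` P'" using unc by (auto simp: R_def)
    qed
    also have "\<dots> = card {x \<in> {1..N}. regular x} - card (fst ` P')"
    proof (rule card_Diff_subset)
      show "finite (fst ` P')" using finite_subset[OF PP'(2) finP] by simp
      show "fst ` P' \<subseteq> {x \<in> {1..N}. regular x}" using PP'(2) P(1) by (auto simp: cells_def)
    qed
    also have "card (fst ` P') = card P'"
      using inj_on_subset[OF non_attacking_inj(1)[OF P(2)] PP'(2)] by (simp add: card_image)
    also have "card {x \<in> {1..N}. regular x} - card P' \<le> d + 8 * w" using P(3) cP removed w' by linarith
    finally show ?thesis .
  qed
  have "\<exists>Q. queens_configuration n Q \<and> P' \<subseteq> Q"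
  proof (rule absorb[OF n(1) K(1) naR bd, of P' X "{}"])
    show "4 * card X + card {} + 9 * (n - card R) + 2 < K" using cX w' deficit K(2) by simp
    show "P' \<subseteq> cells" using PP'(2) P(1) by blast
  qed (use unc fin PP' P in \<open>auto simp: R_def\<close>)
  then obtain Q where Q: "queens_configuration n Q" "P' \<subseteq> Q" by blast
  have "card (P - Q) \<le> card (P - P')" using Q finP by (intro card_mono) auto
  then show ?thesis using Q removed w' by (intro exI[of _ Q]) simp
qed

end

section \<open>Counting configurations\<close>

lemma card_small_subsets:
  assumes "finite B"
  shows "card {X. X \<subseteq> B \<and> card X \<le> s} \<le> (card B + 1) ^ s"
proof -
  let ?O = "insert None (Some ` B)"
  let ?W = "{l. set l \<subseteq> ?O \<and> length l = s}"
  have "{X. X \<subseteq> B \<and> card X \<le> s} \<subseteq> (\<lambda>l. {b. Some b \<in> set l}) ` ?W"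
  proof
    fix X assume "X \<in> {X. X \<subseteq> B \<and> card X \<le> s}"
    then have X: "X \<subseteq> B" "card X \<le> s" by auto
    then obtain xs where xs: "set xs = X" "distinct xs"
      using assms finite_distinct_list finite_subset by metis
    define l where "l = map Some xs @ replicate (s - card X) None"
    have "length xs = card X" using xs distinct_card by metis
    then have "l \<in> ?W" using X xs by (auto simp: l_def)
    moreover have "X = {b. Some b \<in> set l}" using xs by (auto simp: l_def)
    ultimately show "X \<in> (\<lambda>l. {b. Some b \<in> set l}) ` ?W" by blast
  qed
  moreover have fin: "finite ?W" using assms by (intro finite_lists_length_eq) simp
  ultimately have "card {X. X \<subseteq> B \<and> card X \<le> s} \<le> card ?W" by (rule surj_card_le[rotated])
  also have "\<dots> = card ?O ^ s" using assms by (intro card_lists_length_eq) simp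
  also have "card ?O = card B + 1" using assms by (simp add: card_image)
  finally show ?thesis .
qed

lemma finite_configurations: "finite {Q. queens_configuration n Q}"
  by (rule finite_subset[of _ "Pow (board n)"]) (auto simp: queens_configuration_def board_def)

text \<open>If a placement differs from some configuration in few queens, it is determined by that configuration,
  a subset of it and few further squares. So completion loses a factor of only \<open>2 ^ n\<close> times a
  polynomial.\<close>
lemma card_completable:
  assumes sub: "\<And>P. P \<in> F \<Longrightarrow> P \<subseteq> board n"
    and compl: "\<And>P. P \<in> F \<Longrightarrow> \<exists>Q. queens_configuration n Q \<and> card (P - Q) \<le> s"
  shows "card F \<le> num_queens n * (2 ^ n * (n\<^sup>2 + 1) ^ s)"
proof -
  obtain q where q: "\<And>P. P \<in> F \<Longrightarrow> queens_configuration n (q P) \<and> card (P - q P) \<le> s"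
    using compl by metis
  let ?C = "{Q. queens_configuration n Q}"
  let ?S = "{X. X \<subseteq> board n \<and> card X \<le> s}"
  let ?T = "SIGMA Q:?C. Pow Q \<times> ?S"
  have finb: "finite (board n)" by (simp add: board_def)
  have cb: "card (board n) = n\<^sup>2" by (simp add: board_def power2_eq_square)
  have finQ: "finite Q" "card Q = n" if "queens_configuration n Q" for Q
    using that finite_subset[OF _ finb] by (auto simp: queens_configuration_def)
  have finS: "finite ?S" using finb by simp
  have finT: "finite ?T" using finite_configurations finQ finS by (intro finite_SigmaI) auto
  have "inj_on (\<lambda>P. (q P, P \<inter> q P, P - q P)) F"
  proof (rule inj_onI)
    fix P P' assume "(q P, P \<inter> q P, P - q P) = (q P', P' \<inter> q P', P' - q P')"
    then show "P = P'" by (metis Int_Diff_Un prod.inject)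
  qed
  moreover have "(\<lambda>P. (q P, P \<inter> q P, P - q P)) ` F \<subseteq> ?T" using q sub by blast
  ultimately have "card F \<le> card ?T" using finT by (rule card_inj_on_le)
  also have "\<dots> = (\<Sum>Q\<in>?C. card (Pow Q \<times> ?S))"
    using finite_configurations finQ finS by (intro card_SigmaI) auto
  also have "\<dots> = (\<Sum>Q\<in>?C. 2 ^ n * card ?S)"
    using finQ by (intro sum.cong refl) (simp add: card_cartesian_product card_Pow)
  also have "\<dots> = num_queens n * (2 ^ n * card ?S)" by (simp add: num_queens_def)
  also have "\<dots> \<le> num_queens n * (2 ^ n * (n\<^sup>2 + 1) ^ s)"
    using card_small_subsets[OF finb, of s] cb by simp
  finally show ?thesis .
qed

lemma num_queens_le: "num_queens n \<le> n ^ n"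
proof -
  let ?I = "{1..int n}"
  let ?G = "\<lambda>f. (\<lambda>x. (x, f x)) ` ?I"
  have "{Q. queens_configuration n Q} \<subseteq> ?G ` (?I \<rightarrow>\<^sub>E ?I)"
  proof
    fix Q assume "Q \<in> {Q. queens_configuration n Q}"
    then have Q: "Q \<subseteq> board n" "card Q = n" "non_attacking Q" by (auto simp: queens_configuration_iff)
    note inj = non_attacking_inj(1)[OF Q(3)]
    have "fst ` Q \<subseteq> ?I" using Q(1) by (auto simp: board_def)
    moreover have "card (fst ` Q) = card ?I" using Q(2) inj by (simp add: card_image)
    ultimately have im: "fst ` Q = ?I" by (intro card_subset_eq) auto
    define f where "f = restrict (\<lambda>x. snd (inv_into Q fst x)) ?I"
    have iv: "inv_into Q fst x \<in> Q" "fst (inv_into Q fst x) = x" if "x \<in> ?I" for x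
      using that im by (simp_all add: inv_into_into f_inv_into_f)
    have "f \<in> ?I \<rightarrow>\<^sub>E ?I" using iv Q(1) by (force simp: f_def board_def)
    moreover have "Q = ?G f"
    proof (intro equalityI subsetI)
      fix c assume c: "c \<in> Q"
      then have "fst c \<in> ?I" using im by blast
      moreover have "inv_into Q fst (fst c) = c" using c inj by (rule inv_into_f_f[rotated])
      ultimately have "c = (fst c, f (fst c))" by (simp add: f_def)
      then show "c \<in> ?G f" using \<open>fst c \<in> ?I\<close> by blast
    next
      fix c assume "c \<in> ?G f"
      then obtain x where x: "x \<in> ?I" "c = (x, f x)" by blast
      then have "c = inv_into Q fst x" using iv[OF x(1)] by (simp add: f_def prod_eq_iff)
      then show "c \<in> Q" using iv x by simp
    qed
    ultimately show "Q \<in> ?G ` (?I \<rightarrow>\<^sub>E ?I)" by blast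
  qed
  moreover have fin: "finite (?I \<rightarrow>\<^sub>E ?I)" by (intro finite_PiE) auto
  ultimately have "num_queens n \<le> card (?I \<rightarrow>\<^sub>E ?I)"
    unfolding num_queens_def by (rule surj_card_le[rotated])
  then show ?thesis by (simp add: card_PiE)
qed

context absorber begin

section \<open>Random queens as matchings of a hypergraph\<close>

text \<open>The four kinds of lines, in the order column, row, rising and falling diagonal, as linear forms in the
  coordinates.\<close>
definition coeff_x :: "nat \<Rightarrow> int" where "coeff_x \<tau> = [1, 0, 1, 1] ! \<tau>"
definition coeff_y :: "nat \<Rightarrow> int" where "coeff_y \<tau> = [0, 1, 1, - 1] ! \<tau>"

definition line :: "nat \<Rightarrow> int \<times> int \<Rightarrow> int" where
  "line \<tau> c = coeff_x \<tau> * fst c + coeff_y \<tau> * snd c"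

definition lines_of :: "int \<times> int \<Rightarrow> (nat \<times> int) set" where
  "lines_of c = (\<lambda>\<tau>. (\<tau>, line \<tau> c mod N)) ` {0..3}"

definition regular_lines :: "(nat \<times> int) set" where
  "regular_lines = {0..3} \<times> {z \<in> {1..N}. regular z}"

lemma tags: "{0..3::nat} = {0, 1, 2, 3}" by auto

lemma coeffs:
  "coeff_x 0 = 1" "coeff_x 1 = 0" "coeff_x (Suc 0) = 0" "coeff_x 2 = 1" "coeff_x 3 = 1"
  "coeff_y 0 = 0" "coeff_y 1 = 1" "coeff_y (Suc 0) = 1" "coeff_y 2 = 1" "coeff_y 3 = - 1"
  by (simp_all add: coeff_x_def coeff_y_def eval_nat_numeral)

lemma attack_iff_line: "attack a b \<longleftrightarrow> (\<exists>\<tau>\<in>{0..3}. line \<tau> a = line \<tau> b)"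
  unfolding tags by (simp add: attack_def line_def coeffs)

lemma regular_mod: "regular (z mod N) \<longleftrightarrow> regular z"
  unfolding regular_def using p_dvd by (simp add: dvd_mod_iff)

lemma regular_line:
  assumes "c \<in> cells" "\<tau> \<in> {0..3}"
  shows "regular (line \<tau> c)"
proof -
  have "regular (fst c)" using cells_fst assms by blast
  moreover have "c \<in> cells \<union> switchable \<union> filler" using assms by blast
  ultimately have "regular (fst c) \<and> regular (snd c) \<and> regular (fst c + snd c) \<and> regular (fst c - snd c)"
    unfolding regular_def using divisibility[of _ c] by blast
  then show ?thesis using assms(2) unfolding tags by (auto simp: line_def coeffs)
qed

lemma irregular_multiple:
  assumes "N dvd z" shows "\<not> regular z"
  unfolding regular_def using dvd_trans[OF p_dvd[of 1] assms] by (auto intro!: bexI[of _ 1])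

lemma regular_range:
  assumes "regular z" shows "z mod N \<in> {1..N}"
proof -
  have "z mod N \<noteq> 0" using irregular_multiple[of z] assms by auto
  moreover have "0 \<le> z mod N" "z mod N < N" using N_pos by simp_all
  ultimately show ?thesis by simp
qed

lemma finite_cells: "finite cells"
  by (rule finite_subset[of _ "{1..N} \<times> {1..N}"]) (auto simp: cells_def)

text \<open>Any two of the four linear forms have determinant 1 or 2 up to sign, a unit modulo the odd \<open>N\<close>.\<close>
lemma two_lines:
  assumes \<tau>: "\<tau> \<in> {0..3}" "\<tau>' \<in> {0..3}" "\<tau> \<noteq> \<tau>'"
    and d: "N dvd line \<tau> a - line \<tau> b" "N dvd line \<tau>' a - line \<tau>' b"
    and ab: "a \<in> cells" "b \<in> cells"
  shows "a = b"
proof -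
  define \<delta> where "\<delta> = coeff_x \<tau> * coeff_y \<tau>' - coeff_x \<tau>' * coeff_y \<tau>"
  define dx where "dx = fst a - fst b"
  define dy where "dy = snd a - snd b"
  have "\<delta> \<in> {1, - 1, 2, - 2}"
    using \<tau> unfolding tags \<delta>_def by (elim insertE emptyE) (simp_all add: coeffs)
  then have cop: "coprime N \<delta>" using N_coprime(1) by auto
  have "\<delta> * dx = coeff_y \<tau>' * (line \<tau> a - line \<tau> b) - coeff_y \<tau> * (line \<tau>' a - line \<tau>' b)"
    by (simp add: \<delta>_def dx_def line_def algebra_simps)
  also have "N dvd \<dots>" using d by (intro dvd_diff[OF dvd_mult dvd_mult])
  finally have "N dvd dx" using cop by (simp add: coprime_dvd_mult_right_iff)
  have "\<delta> * dy = coeff_x \<tau> * (line \<tau>' a - line \<tau>' b) - coeff_x \<tau>' * (line \<tau> a - line \<tau> b)"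
    by (simp add: \<delta>_def dy_def line_def algebra_simps)
  also have "N dvd \<dots>" using d by (intro dvd_diff[OF dvd_mult dvd_mult])
  finally have "N dvd dy" using cop by (simp add: coprime_dvd_mult_right_iff)
  have "fst a = fst b" "snd a = snd b"
    using ab \<open>N dvd dx\<close> \<open>N dvd dy\<close> unfolding dx_def dy_def
    by (auto intro!: eq_if_dvd_diff[of _ N] simp: cells_def)
  then show ?thesis by (simp add: prod_eq_iff)
qed

lemma card_residue:
  assumes "m dvd N" shows "card {x \<in> {1..N}. m dvd x - \<xi>} = nat (N div m)"
proof -
  have "0 \<le> N div m" using N_pos m_pos by (simp add: pos_imp_zdiv_nonneg_iff)
  then have "N = m * int (nat (N div m))" using assms by simp
  then have "{1..N} = {1..<1 + m * int (nat (N div m))}" by auto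
  then show ?thesis using card_residue_class[OF m_pos, of 1 "nat (N div m)" \<xi>] by simp
qed

lemma coprime_m:
  assumes "\<And>t. t \<in> {1..5} \<Longrightarrow> coprime a (int (p t))" shows "coprime a m"
  unfolding m_def by (rule prod_coprime_right) (use assms in auto)

text \<open>On \<open>y = 3 x (mod m)\<close> a form \<open>b x + s y\<close> equals \<open>(b + 3 s) x\<close> modulo \<open>m\<close>. So the form fixes the class of
  \<open>x\<close> modulo \<open>m\<close>, and each \<open>x\<close> in that class has exactly one \<open>y\<close>. The column is treated separately, as
  there \<open>y\<close> is the free coordinate.\<close>
lemma degree_cells:
  assumes mN: "m dvd N" and \<tau>: "\<tau> \<in> {0..3}" and z: "z \<in> {1..N}" "regular z"
  shows "card {c \<in> cells. line \<tau> c mod N = z} = nat (N div m)"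
proof -
  let ?S = "{c \<in> cells. line \<tau> c mod N = z}"
  have zN: "z mod N = z"
  proof -
    have "z \<noteq> N" using z(2) irregular_multiple[of N] by auto
    then show ?thesis using z(1) by simp
  qed
  have line_iff: "line \<tau> c mod N = z \<longleftrightarrow> N dvd line \<tau> c - z" for c
    using zN by (metis mod_eq_dvd_iff)
  show ?thesis
  proof (cases "\<tau> = 0")
    case True
    have "?S = Pair z ` {y \<in> {1..N}. m dvd y - 3 * z}"
    proof (intro equalityI subsetI)
      fix c assume c: "c \<in> ?S"
      then have "N dvd line \<tau> c - z" using line_iff by simp
      then have "N dvd fst c - z" by (simp add: True line_def coeffs)
      then have "fst c = z" using c z by (intro eq_if_dvd_diff[of _ N]) (auto simp: cells_def)
      then show "c \<in> Pair z ` {y \<in> {1..N}. m dvd y - 3 * z}" using c by (auto simp: cells_def)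
    qed (use z zN True in \<open>auto simp: cells_def line_def coeffs\<close>)
    then show ?thesis using card_residue[OF mN] by (simp add: card_image inj_on_def)
  next
    case False
    define b where "b = coeff_x \<tau>"
    define s where "s = coeff_y \<tau>"
    define a where "a = b + 3 * s"
    have s: "s = 1 \<or> s = - 1" and a: "a \<in> {3, 4, - 2}"
      using \<tau> False unfolding tags a_def b_def s_def by (auto simp: coeffs)
    have ca: "coprime a (int (p t))" if "t \<in> {1..5}" for t
      using a prime_not_dvd[OF that, of 2] prime_not_dvd[OF that, of 3] prime_not_dvd[OF that, of 4]
      by (auto simp: coprime_commute)
    have cam: "coprime a m" using ca by (rule coprime_m)
    obtain \<xi> where \<xi>: "m dvd z - a * \<xi>" using ex_solution[OF m_pos cam] by blast
    have class_iff: "m dvd x - \<xi> \<longleftrightarrow> m dvd a * x - z" for x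
    proof -
      have "a * x - z = a * (x - \<xi>) - (z - a * \<xi>)" by (simp add: algebra_simps)
      then have "m dvd a * x - z \<longleftrightarrow> m dvd a * (x - \<xi>)" using \<xi> by (metis dvd_diff_left_iff)
      also have "\<dots> \<longleftrightarrow> m dvd x - \<xi>" using cam by (simp add: coprime_dvd_mult_right_iff coprime_commute)
      finally show ?thesis by simp
    qed
    have l: "line \<tau> c = b * fst c + s * snd c" for c by (simp add: line_def b_def s_def)
    have inj: "inj_on fst ?S"
    proof (rule inj_onI)
      fix c d assume c: "c \<in> ?S" and d: "d \<in> ?S" and eq: "fst c = fst d"
      have "N dvd (line \<tau> c - z) - (line \<tau> d - z)" by (rule dvd_diff) (use c d line_iff in auto)
      moreover have "N dvd line 0 c - line 0 d" using eq by (simp add: line_def coeffs)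
      ultimately show "c = d" using two_lines[of \<tau> 0 c d] \<tau> False c d by auto
    qed
    have "fst ` ?S = {x \<in> {1..N}. m dvd x - \<xi>}"
    proof (intro equalityI subsetI)
      fix x assume "x \<in> fst ` ?S"
      then obtain y where c: "(x, y) \<in> cells" "line \<tau> (x, y) mod N = z" by auto
      have "N dvd line \<tau> (x, y) - z" using c(2) line_iff by blast
      then have "N dvd b * x + s * y - z" by (simp add: l)
      then have 1: "m dvd b * x + s * y - z" using mN dvd_trans by blast
      have 2: "m dvd s * (y - 3 * x)" using c(1) by (simp add: cells_def)
      have "a * x - z = (b * x + s * y - z) - s * (y - 3 * x)" by (simp add: a_def algebra_simps)
      then have "m dvd a * x - z" using dvd_diff[OF 1 2] by (simp only:)
      then show "x \<in> {x \<in> {1..N}. m dvd x - \<xi>}" using class_iff c(1) by (simp add: cells_def)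
    next
      fix x assume x: "x \<in> {x \<in> {1..N}. m dvd x - \<xi>}"
      then have ax: "m dvd a * x - z" using class_iff by simp
      obtain y where y: "y \<in> {1..N}" "N dvd y - s * (z - b * x)" using ex_representative[OF N_pos] by blast
      have ss: "s * s = 1" using s by auto
      have "b * x + s * y - z = s * (y - s * (z - b * x)) + (s * s - 1) * (z - b * x)" by (simp add: algebra_simps)
      then have Nl: "N dvd b * x + s * y - z" using y(2) ss by (simp add: dvd_mult)
      have "regular x" unfolding regular_def
      proof (intro ballI notI)
        fix t assume t: "t \<in> {1..5}" "int (p t) dvd x"
        have "int (p t) dvd a * x - (a * x - z)"
          by (rule dvd_diff[OF dvd_mult[OF t(2)] dvd_trans[OF p_dvd_m[OF t(1)] ax]])
        then show False using z(2) t(1) by (auto simp: regular_def)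
      qed
      moreover have "m dvd y - 3 * x"
      proof -
        have "m dvd (b * x + s * y - z) - (a * x - z)" using dvd_trans[OF mN Nl] ax by (rule dvd_diff)
        then have "m dvd s * ((b * x + s * y - z) - (a * x - z))" by (rule dvd_mult)
        moreover have "s * ((b * x + s * y - z) - (a * x - z)) = y - 3 * x + (s * s - 1) * (y - 3 * x)"
          by (simp add: a_def algebra_simps)
        ultimately show ?thesis using ss by simp
      qed
      ultimately have "(x, y) \<in> cells" using x y by (simp add: cells_def)
      moreover have "N dvd line \<tau> (x, y) - z" using Nl by (simp add: l)
      then have "line \<tau> (x, y) mod N = z" using line_iff by blast
      ultimately show "x \<in> fst ` ?S" by force
    qed
    then have "card ?S = card {x \<in> {1..N}. m dvd x - \<xi>}" using card_image[OF inj] by (simp only:)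
    then show ?thesis using card_residue[OF mN] by simp
  qed
qed

definition M :: nat where "M = card {x \<in> {1..N}. regular x}"

lemma finite_regular: "finite {x \<in> {1..N}. regular x}"
  by (rule finite_subset[of _ "{1..N}"]) auto

lemma hypergraph:
  assumes mN: "m dvd N"
  shows "regular_linear_hypergraph regular_lines cells lines_of (nat (N div m)) M"
proof
  show "finite regular_lines" using finite_regular by (simp add: regular_lines_def)
  show "finite cells" by (rule finite_cells)
  show "lines_of c \<subseteq> regular_lines" if "c \<in> cells" for c
  proof
    fix v assume "v \<in> lines_of c"
    then obtain \<tau> where \<tau>: "\<tau> \<in> {0..3}" "v = (\<tau>, line \<tau> c mod N)" unfolding lines_of_def by blast
    have "regular (line \<tau> c)" using regular_line[OF that \<tau>(1)] .
    then show "v \<in> regular_lines"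
      using \<tau> regular_range[of "line \<tau> c"] regular_mod[of "line \<tau> c"] by (simp add: regular_lines_def)
  qed
  show "card (lines_of c) = 4" for c
    unfolding lines_of_def by (subst card_image) (auto simp: inj_on_def)
  show "card {c \<in> cells. v \<in> lines_of c} = nat (N div m)" if v: "v \<in> regular_lines" for v
  proof -
    obtain \<tau> z where \<tau>: "v = (\<tau>, z)" "\<tau> \<in> {0..3}" "z \<in> {1..N}" "regular z"
      using v by (auto simp: regular_lines_def)
    then have "v \<in> lines_of c \<longleftrightarrow> line \<tau> c mod N = z" for c by (auto simp: lines_of_def)
    then show ?thesis using degree_cells[OF mN \<tau>(2,3,4)] by simp
  qed
  show "c = d" if cd: "c \<in> cells" "d \<in> cells" and u: "u \<in> lines_of c" "u \<in> lines_of d"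
    and v: "v \<in> lines_of c" "v \<in> lines_of d" and "u \<noteq> v" for c d u v
  proof -
    obtain \<tau> where \<tau>: "\<tau> \<in> {0..3}" "u = (\<tau>, line \<tau> c mod N)" using u(1) unfolding lines_of_def by blast
    obtain \<tau>' where \<tau>': "\<tau>' \<in> {0..3}" "v = (\<tau>', line \<tau>' c mod N)" using v(1) unfolding lines_of_def by blast
    have "line \<tau> c mod N = line \<tau> d mod N" "line \<tau>' c mod N = line \<tau>' d mod N"
      using u(2) v(2) \<tau>(2) \<tau>'(2) by (auto simp: lines_of_def)
    then have "N dvd line \<tau> c - line \<tau> d" "N dvd line \<tau>' c - line \<tau>' d"
      by (simp_all add: mod_eq_dvd_iff)
    moreover have "\<tau> \<noteq> \<tau>'" using \<open>u \<noteq> v\<close> \<tau> \<tau>' by auto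
    ultimately show "c = d" using two_lines[of \<tau> \<tau>' c d] \<tau>(1) \<tau>'(1) cd by blast
  qed
  show "card regular_lines = 4 * M" by (simp add: regular_lines_def card_cartesian_product M_def)
  have "m \<le> N" using zdvd_imp_le[OF mN N_pos] .
  then have "0 < N div m" using m_pos by (simp add: pos_imp_zdiv_pos_iff)
  then show "0 < nat (N div m)" by simp
  have "{x \<in> {1..N}. m dvd x - 1} \<subseteq> {x \<in> {1..N}. regular x}"
  proof
    fix x assume x: "x \<in> {x \<in> {1..N}. m dvd x - 1}"
    have "\<not> int (p t) dvd x" if t: "t \<in> {1..5}" for t
    proof
      assume "int (p t) dvd x"
      moreover have "int (p t) dvd x - 1" using x p_dvd_residue[OF t] by blast
      ultimately have "int (p t) dvd x - (x - 1)" by (rule dvd_diff)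
      then show False using p_gt[OF t] by simp
    qed
    then show "x \<in> {x \<in> {1..N}. regular x}" using x by (simp add: regular_def)
  qed
  then show "nat (N div m) \<le> M"
    unfolding M_def card_residue[OF mN, symmetric, of 1] by (intro card_mono finite_regular)
qed

lemma M_le: "int M \<le> N"
proof -
  have "M \<le> card {1..N}" unfolding M_def by (intro card_mono) auto
  then show ?thesis using N_pos by simp
qed

text \<open>Each prime divides only few columns, so the reserved part costs a small proportion of the queens.\<close>
lemma M_ge:
  assumes B: "\<And>t. t \<in> {1..5} \<Longrightarrow> B \<le> p t" and "0 < B"
  shows "real_of_int N * (1 - 5 / real B) \<le> real M"
proof -
  have "{1..N} \<subseteq> {x \<in> {1..N}. regular x} \<union> (\<Union>t\<in>{1..5}. {x \<in> {1..N}. int (p t) dvd x})"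
    by (auto simp: regular_def)
  then have "card {1..N} \<le> card ({x \<in> {1..N}. regular x} \<union> (\<Union>t\<in>{1..5}. {x \<in> {1..N}. int (p t) dvd x}))"
    by (intro card_mono) (auto intro: finite_subset[of _ "{1..N}"])
  also have "\<dots> \<le> M + (\<Sum>t\<in>{1..5}. card {x \<in> {1..N}. int (p t) dvd x})"
    unfolding M_def by (intro order_trans[OF card_Un_le] add_mono card_UN_le) auto
  finally have "real (card {1..N}) \<le> real (M + (\<Sum>t\<in>{1..5}. card {x \<in> {1..N}. int (p t) dvd x}))"
    by (rule of_nat_mono)
  then have "real (card {1..N}) \<le> real M + (\<Sum>t\<in>{1..5}. real (card {x \<in> {1..N}. int (p t) dvd x}))"
    unfolding of_nat_add of_nat_sum .
  also have "\<dots> \<le> real M + (\<Sum>t\<in>{1..5::nat}. real_of_int N / real B)"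
  proof (intro add_left_mono sum_mono)
    fix t :: nat assume t: "t \<in> {1..5}"
    have p0: "0 < int (p t)" using p_gt[OF t] by simp
    define k where "k = nat (N div int (p t))"
    have "0 \<le> N div int (p t)" using N_pos p0 by (simp add: pos_imp_zdiv_nonneg_iff)
    then have N: "N = int (p t) * int k" using p_dvd[OF t] by (simp add: k_def)
    then have "{1..N} = {1..<1 + int (p t) * int k}" by auto
    then have "card {x \<in> {1..N}. int (p t) dvd x} = k"
      using card_residue_class[OF p0, of 1 k 0] by simp
    moreover have "real B * real k \<le> real (p t) * real k" using B[OF t] by (intro mult_right_mono) auto
    moreover have "real_of_int N = real (p t) * real k" using N by simp
    ultimately show "real (card {x \<in> {1..N}. int (p t) dvd x}) \<le> real_of_int N / real B"
      using \<open>0 < B\<close> by (simp add: field_simps)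
  qed
  finally show ?thesis using N_pos by (simp add: algebra_simps)
qed

theorem num_queens_lower:
  assumes mN: "m dvd N" and n: "N \<le> int n" "int n \<le> N + int w"
    and \<delta>: "0 < \<delta>" "\<delta> \<le> 1" and T: "1 \<le> T" "1 \<le> real T * (\<delta> / 4) ^ 4"
    and L0: "0 \<le> L0" "1 + ln (4 / \<delta>) \<le> L0 * exp (- 2 * \<kappa> * real T)"
    and D: "D = nat (N div m)" "5 * exp L0 \<le> real D" "2 * \<kappa> \<le> real D" "T \<le> D"
    and K: "576 * (m * int K) < N" "9 * (nat \<lceil>\<delta> * real M\<rceil> + 8 * w) + 8 * w + 2 < K"
  shows "1 / 2 * (real D / real T) powr ((1 - \<delta>) * real M)
     \<le> real (num_queens n * (2 ^ n * (n\<^sup>2 + 1) ^ (8 * w)))"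
proof -
  interpret H: regular_linear_hypergraph regular_lines cells lines_of D M
    unfolding D(1) by (rule hypergraph[OF mN])
  define F where "F = {G \<in> H.matchings. (1 - \<delta>) * real M \<le> real (card G)}"
  have "1 / 2 * (real D / real T) powr ((1 - \<delta>) * real M) \<le> real (card F)"
    unfolding F_def using H.many_near_perfect_matchings[OF \<delta> T L0 D(2-4)] .
  also have "card F \<le> num_queens n * (2 ^ n * (n\<^sup>2 + 1) ^ (8 * w))"
  proof (rule card_completable)
    fix G assume "G \<in> F"
    then have G: "G \<subseteq> cells" "(1 - \<delta>) * real M \<le> real (card G)"
      and disj: "\<And>c d. c \<in> G \<Longrightarrow> d \<in> G \<Longrightarrow> c \<noteq> d \<Longrightarrow> lines_of c \<inter> lines_of d = {}"
      unfolding F_def H.matchings_def by blast+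
    show "G \<subseteq> board n" using G(1) n(1) by (force simp: cells_def board_def)
    have na: "non_attacking G" unfolding non_attacking_def
    proof (intro ballI impI notI)
      fix c d assume cd: "c \<in> G" "d \<in> G" "c \<noteq> d" "attack c d"
      then obtain \<tau> where \<tau>: "\<tau> \<in> {0..3}" "line \<tau> c = line \<tau> d" unfolding attack_iff_line by blast
      have "(\<tau>, line \<tau> c mod N) \<in> lines_of c \<inter> lines_of d"
        using \<tau> unfolding lines_of_def by auto
      then show False using disj cd by blast
    qed
    have "real M \<le> real (card G) + \<delta> * real M" using G(2) by (simp add: algebra_simps)
    also have "\<delta> * real M \<le> real (nat \<lceil>\<delta> * real M\<rceil>)" by (rule real_nat_ceiling_ge)
    finally have "card {x \<in> {1..N}. regular x} \<le> card G + nat \<lceil>\<delta> * real M\<rceil>"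
      unfolding M_def[symmetric] by linarith
    then show "\<exists>Q. queens_configuration n Q \<and> card (G - Q) \<le> 8 * w"
      by (rule completion[OF n G(1) na _ K])
  qed
  finally show ?thesis by simp
qed

end

section \<open>The limit\<close>

lemma ex_five_primes: "\<exists>p. (\<forall>t\<in>{1..5}. prime (p t) \<and> B < p t) \<and> inj_on p {1..5::nat}" for B :: nat
proof -
  have inf: "infinite {q::nat. prime q \<and> B < q}"
  proof
    assume fin: "finite {q::nat. prime q \<and> B < q}"
    have "{q::nat. prime q} \<subseteq> {q. prime q \<and> B < q} \<union> {..B}" by auto
    then have "finite {q::nat. prime q}" using fin finite_subset by blast
    then show False using primes_infinite by simp
  qed
  obtain p :: "nat \<Rightarrow> nat" where p: "inj p" "range p \<subseteq> {q. prime q \<and> B < q}"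
    using infinite_countable_subset[OF inf] by blast
  have "prime (p t) \<and> B < p t" for t using p(2) by blast
  moreover have "inj_on p {1..5}" using p(1) by (rule inj_on_subset) simp
  ultimately show ?thesis by blast
qed

lemma coprime_690:
  assumes "prime q" "23 < q" shows "coprime q (690::nat)"
proof (rule prime_imp_coprime[OF assms(1)])
  show "\<not> q dvd 690"
  proof
    assume "q dvd 690"
    then have "q dvd 2 * (3 * (5 * 23))" by simp
    then have "q dvd 2 \<or> q dvd 3 \<or> q dvd 5 \<or> q dvd 23"
      using assms(1) by (simp only: prime_dvd_mult_iff)
    then have "q \<le> 23" by (auto dest: dvd_imp_le)
    then show False using assms(2) by simp
  qed
qed

text \<open>The constants are chosen in the order \<open>B\<close> (primes beyond \<open>40 / \<epsilon>\<close> keep the reserved part small), the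
  primes and \<open>m\<close>, then \<open>\<delta>\<close> (of order \<open>\<epsilon> / m\<close>, so that the number of switchings stays below the number
  of candidates), then \<open>T\<close> and \<open>L0\<close>. As \<open>N\<close> one takes \<open>m\<close> times a number that is 1 modulo 690, which is
  possible within a bounded distance of \<open>n\<close>.\<close>
lemma eventually_lower_bound:
  assumes \<epsilon>: "0 < \<epsilon>" "\<epsilon> < 1"
  shows "eventually (\<lambda>n. 1 - \<epsilon> \<le> ln (real (num_queens n)) / (real n * ln (real n))) sequentially"
proof -
  define B where "B = max 24 (nat \<lceil>40 / \<epsilon>\<rceil>)"
  have B: "0 < B" "23 < B" "40 / \<epsilon> \<le> real B"
    unfolding B_def by (auto simp: le_max_iff_disj) linarith
  obtain p where p: "\<And>t. t \<in> {1..5} \<Longrightarrow> prime (p t) \<and> B < p t" "inj_on p {1..5::nat}"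
    using ex_five_primes[of B] by blast
  define m where "m = (\<Prod>t\<in>{1..5}. p t)"
  have m0: "0 < m" unfolding m_def using p by (intro prod_pos) fastforce
  have copm: "coprime m 690"
    unfolding m_def by (rule prod_coprime_left) (use p B coprime_690 in fastforce)
  define s where "s = 690 * m"
  define \<delta> where "\<delta> = \<epsilon> / (12000 * real m)"
  define T where "T = nat \<lceil>1 / (\<delta> / 4) ^ 4\<rceil>"
  define L0 where "L0 = (1 + ln (4 / \<delta>)) * exp (2 * \<kappa> * real T)"
  define Dmin where "Dmin = Max {5 * exp L0, 2 * \<kappa>, real T, 2000 * (80 * real s + 12)}"
  define c where "c = 1 - \<epsilon> / 8"
  define r where "r = real m * real T"
  have \<delta>: "0 < \<delta>" "\<delta> \<le> 1" "\<delta> \<le> \<epsilon> / 8" "\<delta> * real m = \<epsilon> / 12000"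
  proof -
    show "0 < \<delta>" "\<delta> * real m = \<epsilon> / 12000" using \<epsilon> m0 by (simp_all add: \<delta>_def)
    have "8 \<le> 12000 * real m" using m0 by (simp add: Suc_le_eq)
    then show "\<delta> \<le> \<epsilon> / 8" using \<epsilon> unfolding \<delta>_def by (intro divide_left_mono) auto
    then show "\<delta> \<le> 1" using \<epsilon> by simp
  qed
  have T: "1 \<le> real T * (\<delta> / 4) ^ 4" "1 \<le> T"
  proof -
    have "1 / (\<delta> / 4) ^ 4 \<le> real T" unfolding T_def by (rule real_nat_ceiling_ge)
    then show 1: "1 \<le> real T * (\<delta> / 4) ^ 4" using \<delta> by (simp add: field_simps)
    then show "1 \<le> T" by (cases "T = 0") auto
  qed
  have "0 \<le> ln (4 / \<delta>)" using \<delta> by simp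
  then have L0: "0 \<le> L0" "1 + ln (4 / \<delta>) \<le> L0 * exp (- 2 * \<kappa> * real T)"
    by (simp_all add: L0_def mult.assoc flip: exp_add)
  have Dmin: "5 * exp L0 \<le> Dmin" "2 * \<kappa> \<le> Dmin" "real T \<le> Dmin" "2000 * (80 * real s + 12) \<le> Dmin"
    unfolding Dmin_def by (auto intro: Max_ge)
  have r0: "0 < r" using m0 T by (simp add: r_def)
  have c0: "0 < c" "c\<^sup>2 > 1 - \<epsilon>" using \<epsilon> by (auto simp: c_def power2_eq_square algebra_simps add_pos_pos)
  define h where "h = (\<lambda>n. c\<^sup>2 * ((real n - real s) * ln ((real n - real s) / r))
     - ln 2 - real n * ln 2 - 8 * real s * ln ((real n)\<^sup>2 + 1))"
  have "(\<lambda>n. h n / (real n * ln (real n))) \<longlonglongrightarrow> c\<^sup>2"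
    unfolding h_def using r0 c0(1) by real_asymp
  then have ev: "eventually (\<lambda>n. 1 - \<epsilon> < h n / (real n * ln (real n))) sequentially"
    using c0(2) by (rule order_tendstoD(1))
  have main: "h n \<le> ln (real (num_queens n))"
    if n: "m \<le> n" "real s + real m * Dmin \<le> real n" "2 \<le> n" for n
  proof -
    define i where "i = (n - m) div s"
    define k where "k = 690 * i + 1"
    define N where "N = m * k"
    have s0: "0 < s" using m0 by (simp add: s_def)
    have Ni: "N = s * i + m" by (simp add: N_def k_def s_def algebra_simps)
    have "s * i \<le> n - m" "n - m < s * i + s"
    proof -
      have "n - m = s * i + (n - m) mod s" by (simp add: i_def)
      then show "s * i \<le> n - m" "n - m < s * i + s"
        using mod_less_divisor[OF s0, of "n - m"] by linarith+
    qed
    then have Nn: "N \<le> n" "n < N + s" using n(1) Ni by linarith+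
    have kD: "Dmin \<le> real k"
    proof -
      have "real m * Dmin \<le> real N" using n(2) Nn by linarith
      then show ?thesis using m0 by (simp add: N_def)
    qed
    have N0: "0 < N" using m0 by (simp add: N_def k_def)
    interpret S: absorber p "int N"
    proof
      show "coprime (int N) 690"
      proof -
        have "coprime k 690" unfolding k_def by (metis coprime_add_one_right coprime_commute coprime_mult_left_iff)
        then have "coprime N 690" using copm by (simp add: N_def)
        then show ?thesis by (metis coprime_int_iff of_nat_numeral)
      qed
      show "int (p t) dvd int N" if "t \<in> {1..5}" for t
      proof -
        have "p t dvd m" unfolding m_def by (rule dvd_prodI) (use that in auto)
        then have "p t dvd N" unfolding N_def by (rule dvd_mult2)
        then show ?thesis by (simp only: of_nat_dvd_iff)
      qed
      show "prime (p t)" "23 < p t" if "t \<in> {1..5}" for t using p(1)[OF that] B(2) by auto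
      show "inj_on p {1..5}" "0 < int N" using p(2) N0 by auto
    qed
    have Sm: "S.m = int m" by (simp add: S.m_def m_def)
    define K where "K = k div 600"
    define d where "d = nat \<lceil>\<delta> * real S.M\<rceil>"
    have MN: "S.M \<le> N" using S.M_le by simp
    have K1: "576 * (S.m * int K) < int N"
    proof -
      have "600 * K \<le> k" by (simp add: K_def)
      then have "m * (600 * K) \<le> m * k" by (rule mult_le_mono2)
      then have "600 * (m * K) \<le> N" by (simp add: N_def mult_ac)
      then have "576 * (m * K) < N" using N0 by linarith
      then have "int (576 * (m * K)) < int N" by (simp only: of_nat_less_iff)
      then show ?thesis unfolding Sm by simp
    qed
    have K2: "9 * (d + 8 * s) + 8 * s + 2 < K"
    proof -
      have "\<delta> * real S.M \<le> \<delta> * real N" using MN \<delta> by (intro mult_left_mono) auto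
      also have "\<dots> = \<epsilon> / 12000 * real k" using \<delta>(4) by (simp add: N_def)
      also have "\<dots> \<le> real k / 12000" using \<epsilon> by (simp add: mult_left_le_one_le)
      finally have "real d \<le> real k / 12000 + 1"
        unfolding d_def using \<delta> by (smt (verit) of_nat_nat of_int_ceiling_le_add_one zero_le_ceiling mult_nonneg_nonneg of_nat_0_le_iff)
      moreover have "real k < 600 * (real K + 1)"
      proof -
        have "k < 600 * (K + 1)" using dividend_less_times_div[of 600 k] by (simp add: K_def)
        then have "real k < real (600 * (K + 1))" by (simp only: of_nat_less_iff)
        then show ?thesis by simp
      qed
      moreover have "2000 * (80 * real s + 12) \<le> real k" using Dmin(4) kD by linarith
      moreover have "0 \<le> real s" by simp
      moreover have "9 * (d' + 8 * s') + 8 * s' + 2 < K'"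
        if "d' \<le> k' / 12000 + 1" "k' < 600 * (K' + 1)" "2000 * (80 * s' + 12) \<le> k'" "0 \<le> s'"
        for d' k' K' s' :: real
        using that by (simp add: field_simps)
      ultimately have "9 * (real d + 8 * real s) + 8 * real s + 2 < real K" by blast
      then have "real (9 * (d + 8 * s) + 8 * s + 2) < real K" by simp
      then show ?thesis by (simp only: of_nat_less_iff)
    qed
    have kdiv: "k = nat (int N div S.m)" unfolding Sm using m0 by (simp add: N_def)
    let ?X = "2 ^ n * (n\<^sup>2 + 1) ^ (8 * s)"
    have low: "1 / 2 * (real k / real T) powr ((1 - \<delta>) * real S.M) \<le> real (num_queens n * ?X)"
    proof (rule S.num_queens_lower[OF _ _ _ \<delta>(1,2) T(2,1) L0 kdiv _ _ _ K1])
      show "S.m dvd int N" unfolding Sm by (simp add: N_def)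
      show "int N \<le> int n" "int n \<le> int N + int s" using Nn by simp_all
      show "5 * exp L0 \<le> real k" "2 * \<kappa> \<le> real k" using Dmin kD by linarith+
      show "T \<le> k" using Dmin(3) kD by linarith
      show "9 * (nat \<lceil>\<delta> * real S.M\<rceil> + 8 * s) + 8 * s + 2 < K" using K2 by (simp add: d_def)
    qed
    have kT: "0 < real k / real T" using T(2) by (simp add: k_def)
    have pos: "0 < 1 / 2 * (real k / real T) powr ((1 - \<delta>) * real S.M)"
      using T(2) by (simp add: k_def)
    then have Q0: "0 < num_queens n" using low by (auto intro: Nat.gr0I)
    have "ln (1 / 2 * (real k / real T) powr ((1 - \<delta>) * real S.M)) \<le> ln (real (num_queens n * ?X))"
      by (rule iffD2[OF ln_le_cancel_iff[OF pos less_le_trans[OF pos low]] low])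
    also have "\<dots> = ln (real (num_queens n)) + real n * ln 2 + 8 * real s * ln ((real n)\<^sup>2 + 1)"
    proof -
      have "0 < (real n)\<^sup>2 + 1" by (simp add: add_nonneg_pos)
      then show ?thesis using Q0 by (simp add: ln_mult ln_realpow)
    qed
    also have "ln (1 / 2 * (real k / real T) powr ((1 - \<delta>) * real S.M))
        = (1 - \<delta>) * real S.M * ln (real k / real T) - ln 2"
    proof -
      have "ln (1 / 2 * y powr a) = a * ln y - ln 2" if "0 < y" for y a :: real
        using that by (simp add: ln_mult ln_powr ln_div)
      then show ?thesis using kT by blast
    qed
    finally have ineq: "(1 - \<delta>) * real S.M * ln (real k / real T) - ln 2
        \<le> ln (real (num_queens n)) + real n * ln 2 + 8 * real s * ln ((real n)\<^sup>2 + 1)" .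
    have ns: "0 < real n - real s" "real n - real s \<le> real N"
    proof -
      have "0 < 2000 * (80 * real s + 12)" by (simp add: add_nonneg_pos)
      then have "0 < Dmin" using Dmin(4) by (rule less_le_trans)
      then have "0 < real m * Dmin" using m0 by simp
      then show "0 < real n - real s" using n(2) by linarith
      show "real n - real s \<le> real N" using Nn by linarith
    qed
    have "c\<^sup>2 * ((real n - real s) * ln ((real n - real s) / r)) \<le> (1 - \<delta>) * real S.M * ln (real k / real T)"
    proof -
      have "real n - real s \<le> real m * real k" using ns by (simp add: N_def)
      then have le: "(real n - real s) / r \<le> real k / real T"
      proof -
        have "(real n - real s) / r \<le> real m * real k / r"
          using \<open>real n - real s \<le> real m * real k\<close> r0 by (intro divide_right_mono) auto
        also have "\<dots> = real k / real T" using m0 by (simp add: r_def)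
        finally show ?thesis .
      qed
      have ge1: "1 \<le> real k / real T" using Dmin(3) kD T(2) by (simp add: le_divide_eq)
      have "ln ((real n - real s) / r) \<le> ln (real k / real T)"
        by (rule iffD2[OF ln_le_cancel_iff[OF _ kT] le]) (use ns r0 in simp)
      have cM: "c * (real n - real s) \<le> real S.M"
      proof -
        have "5 / real B \<le> \<epsilon> / 8" using B \<epsilon> by (simp add: field_simps)
        then have "c * (real n - real s) \<le> (1 - 5 / real B) * real N"
          using ns c0 unfolding c_def by (intro mult_mono) auto
        also have "\<dots> \<le> real S.M" using S.M_ge[of B] p(1) B(1) by (fastforce simp: mult.commute)
        finally show ?thesis .
      qed
      have "c\<^sup>2 * ((real n - real s) * ln ((real n - real s) / r)) = (c * (c * (real n - real s))) * ln ((real n - real s) / r)"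
        by (simp add: power2_eq_square mult.assoc)
      also have "\<dots> \<le> (c * (c * (real n - real s))) * ln (real k / real T)"
        using \<open>ln ((real n - real s) / r) \<le> ln (real k / real T)\<close> c0 ns by (intro mult_left_mono) auto
      also have "\<dots> \<le> ((1 - \<delta>) * real S.M) * ln (real k / real T)"
      proof (intro mult_right_mono mult_mono)
        show "c \<le> 1 - \<delta>" using \<delta>(3) by (simp add: c_def)
      qed (use cM c0 ns \<delta> ge1 in auto)
      finally show ?thesis .
    qed
    then show ?thesis using ineq unfolding h_def by linarith
  qed
  have "eventually (\<lambda>n. m + nat \<lceil>real s + real m * Dmin\<rceil> + 2 \<le> n) sequentially" by (rule eventually_ge_at_top)
  then show ?thesis using ev
  proof eventually_elim
    case (elim n)
    have "real s + real m * Dmin \<le> real n"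
    proof -
      have "real s + real m * Dmin \<le> real (nat \<lceil>real s + real m * Dmin\<rceil>)" by (rule real_nat_ceiling_ge)
      also have "\<dots> \<le> real n" by (rule of_nat_mono) (use elim(1) in linarith)
      finally show ?thesis .
    qed
    then have "h n \<le> ln (real (num_queens n))" using elim(1) by (intro main) auto
    moreover have "0 < real n * ln (real n)" using elim(1) by simp
    ultimately have "h n / (real n * ln (real n)) \<le> ln (real (num_queens n)) / (real n * ln (real n))"
      by (intro divide_right_mono) auto
    then show ?case using elim(2) by linarith
  qed
qed

lemma eventually_upper_bound:
  "eventually (\<lambda>n. ln (real (num_queens n)) / (real n * ln (real n)) \<le> 1) sequentially"
  using eventually_ge_at_top[of 2]
proof eventually_elim
  case (elim n)
  have pos: "0 < real n * ln (real n)" using elim by simp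
  have "ln (real (num_queens n)) \<le> real n * ln (real n)"
  proof (cases "num_queens n = 0")
    case True
    then show ?thesis using pos by simp
  next
    case False
    have "real (num_queens n) \<le> real n ^ n" using num_queens_le[of n] by (metis of_nat_mono of_nat_power)
    then have "ln (real (num_queens n)) \<le> ln (real n ^ n)" using False elim by (subst ln_le_cancel_iff) auto
    then show ?thesis using elim by (simp add: ln_realpow)
  qed
  then show ?case using pos by (simp add: divide_le_eq)
qed

theorem mainTheorem2:
  shows "(\<lambda>n. ln (real (num_queens n)) / (real n * ln (real n))) \<longlonglongrightarrow> 1"
proof (rule order_tendstoI)
  fix a :: real assume "a < 1"
  define \<epsilon> where "\<epsilon> = min (1 / 2) ((1 - a) / 2)"
  have "0 < \<epsilon>" "\<epsilon> < 1" "a < 1 - \<epsilon>" using \<open>a < 1\<close> by (auto simp: \<epsilon>_def min_def field_simps)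
  then show "eventually (\<lambda>n. a < ln (real (num_queens n)) / (real n * ln (real n))) sequentially"
    using eventually_lower_bound[of \<epsilon>] by (auto elim!: eventually_mono)
next
  fix a :: real assume "1 < a"
  then show "eventually (\<lambda>n. ln (real (num_queens n)) / (real n * ln (real n)) < a) sequentially"
    using eventually_upper_bound by (auto elim!: eventually_mono)
qed

end
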